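(* Let $(X,d,\mu,\mathcal E,\mathcal F)$ be a sub-Gaussian Dirichlet space with parameters $d_H,d_W$ that satisfies $wBE(\kappa)$ with $\kappa=d_W-\lambda_1^\#$. Assume $\kappa=d_W-d_H>0$. Then $BV(X)\subset L^\infty(X,\mu)$ and there exists a constant $C>0$ such that for every $f\in BV(X)$, $$\mathbf{Osc}(f)\le C\,\mathbf{Var}(f),$$ where $\mathbf{Osc}(f)$ denotes the essential supremum of $|f(x)-f(y)|$ over $x,y\in X$.
   Context: A sub-Gaussian Dirichlet space $(X,d,\mu,\mathcal E,\mathcal F)$ with parameters $d_H,d_W$ means: $(X,d,\mu)$ is a locally compact metric measure space, $\mu$ is a Radon measure with support $X$, $(\mathcal E,\mathcal F)$ is a Dirichlet form on $L^2(X,\mu)$, and (i) every ball $B(x,r)=\{y: d(x,y)<r\}$, $x\in X$, $0<r<\infty$, has compact closure; (ii) $\mu$ is Ahlfors $d_H$-regular: there are $c_1,c_2,d_H\in(0,\infty)$ with $c_1r^{d_H}\le\mu(B(x,r))\le c_2r^{d_H}$ for all $x\in X$, $r\in[0,\infty)$; (iii) $\mathcal E$ is regular and strongly local (i.e. $\mathcal E(u,v)=0$ for $u,v\in\mathcal F$ with compact supports such that $u$ is constant in a neighborhood of the support of $v$); (iv) the heat semigroup $\{P_t\}$ of $(\mathcal E,\mathcal F)$ has a continuous heat kernel $p_t(x,y)$ (so $P_tg(x)=\int_Xp_t(x,y)g(y)\,d\mu(y)$) satisfying, for some $c_3,c_4,c_5,c_6\in(0,\infty)$ and $d_W\in(2,\infty)$,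 $$c_5t^{-d_H/d_W}\exp\Big(-c_6\Big(\tfrac{d(x,y)^{d_W}}{t}\Big)^{\frac1{d_W-1}}\Big)\le p_t(x,y)\le c_3t^{-d_H/d_W}\exp\Big(-c_4\Big(\tfrac{d(x,y)^{d_W}}{t}\Big)^{\frac1{d_W-1}}\Big)$$ for $\mu\times\mu$-a.e. $(x,y)$ and all $t>0$. In this setting $P_t1=1$. $X$ satisfies $wBE(\kappa)$ if $0<\kappa<d_W$ and there is $C>0$ such that $|P_tg(x)-P_tg(y)|\le C\frac{d(x,y)^\kappa}{t^{\kappa/d_W}}\|g\|_{L^\infty(X,\mu)}$ for all $t>0$, $g\in L^\infty(X,\mu)$, $x,y\in X$. Let $\Delta_r=\{(x,y)\in X\times X: d(x,y)<r\}$. For $\lambda>0$, $KS^{\lambda,1}(X)$ is the set of $f\in L^1(X,\mu)$ such that $\limsup_{r\to0^+}\iint_{\Delta_r}\frac{|f(y)-f(x)|}{r^\lambda\mu(B(x,r))}\,d\mu(y)\,d\mu(x)<\infty$. Set $\lambda_1^\#=\sup\{\lambda>0: KS^{\lambda,1}(X)\text{ contains non-constant functions}\}$, $BV(X)=KS^{\lambda_1^\#,1}(X)$, and for $f\in BV(X)$ $$\mathbf{Var}(f)=\liminf_{r\to0^+}\iint_{\Delta_r}\frac{|f(y)-f(x)|}{r^{\lambda_1^\#}\mu(B(x,r))}\,d\mu(y)\,d\mu(x).$$ *)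

theory Defs
  imports "HOL-Analysis.Analysis" "HOL-Probability.Essential_Supremum"
begin

text \<open>
  The space \<open>X\<close> is the universe of a type of class \<^class>\<open>metric_space\<close>. Elements of the Lebesgue
  spaces are represented by Borel functions, so equality of elements is equality almost everywhere.
\<close>

definition radon_measure :: "'a::topological_space measure \<Rightarrow> bool" where
  "radon_measure M \<longleftrightarrow>
     sets M = sets borel \<and>
     (\<forall>K. compact K \<longrightarrow> emeasure M K < \<infinity>) \<and>
     (\<forall>A\<in>sets borel. emeasure M A = (INF U\<in>{U. open U \<and> A \<subseteq> U}. emeasure M U)) \<and>
     (\<forall>U. open U \<longrightarrow> emeasure M U = (SUP K\<in>{K. compact K \<and> K \<subseteq> U}. emeasure M K))"

definition ahlfors_regular :: "'a::metric_space measure \<Rightarrow> real \<Rightarrow> bool" where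
  "ahlfors_regular M dH \<longleftrightarrow> dH > 0 \<and>
     (\<exists>c1>0. \<exists>c2>0. \<forall>x. \<forall>r\<ge>0.
        ennreal (c1 * r powr dH) \<le> emeasure M (ball x r) \<and>
        emeasure M (ball x r) \<le> ennreal (c2 * r powr dH))"

definition L2 :: "'a measure \<Rightarrow> ('a \<Rightarrow> real) set" where
  "L2 M = {f \<in> borel_measurable M. integrable M (\<lambda>x. (f x)\<^sup>2)}"

definition L2_inner :: "'a measure \<Rightarrow> ('a \<Rightarrow> real) \<Rightarrow> ('a \<Rightarrow> real) \<Rightarrow> real" where
  "L2_inner M f g = (\<integral>x. f x * g x \<partial>M)"

definition L2_normsq :: "'a measure \<Rightarrow> ('a \<Rightarrow> real) \<Rightarrow> real" where
  "L2_normsq M f = (\<integral>x. (f x)\<^sup>2 \<partial>M)"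

definition Linf_norm :: "'a measure \<Rightarrow> ('a \<Rightarrow> real) \<Rightarrow> ennreal" where
  "Linf_norm M f = esssup M (\<lambda>x. ennreal \<bar>f x\<bar>)"

definition Linf :: "'a measure \<Rightarrow> ('a \<Rightarrow> real) set" where
  "Linf M = {f \<in> borel_measurable M. Linf_norm M f < \<infinity>}"

text \<open>The squared norm of the form domain, i.e. \<open>E\<^sub>1(u,u) = E(u,u) + \<parallel>u\<parallel>\<^sup>2\<close>.\<close>

definition form_normsq ::
    "'a measure \<Rightarrow> (('a \<Rightarrow> real) \<Rightarrow> ('a \<Rightarrow> real) \<Rightarrow> real) \<Rightarrow> ('a \<Rightarrow> real) \<Rightarrow> real" where
  "form_normsq M E u = E u u + L2_normsq M u"

text \<open>A Dirichlet form on \<open>L\<^sup>2(M)\<close>: a densely defined, nonnegative, symmetric bilinear form that is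
  closed and Markovian. The first two axioms on \<open>E\<close> and \<open>F\<close> make them well defined on classes of
  functions modulo equality almost everywhere.\<close>

locale dirichlet_form =
  fixes M :: "'a::metric_space measure"
    and E :: "('a \<Rightarrow> real) \<Rightarrow> ('a \<Rightarrow> real) \<Rightarrow> real"
    and F :: "('a \<Rightarrow> real) set"
  assumes domain_AE_cong:
      "\<And>u v. u \<in> F \<Longrightarrow> v \<in> borel_measurable M \<Longrightarrow> (AE x in M. u x = v x) \<Longrightarrow> v \<in> F"
    and form_AE_cong:
      "\<And>u v w. u \<in> F \<Longrightarrow> v \<in> F \<Longrightarrow> w \<in> F \<Longrightarrow> (AE x in M. u x = v x) \<Longrightarrow> E u w = E v w"
    and domain_L2: "F \<subseteq> L2 M"
    and domain_zero: "(\<lambda>x. 0) \<in> F"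
    and domain_lin: "\<And>a b u v. u \<in> F \<Longrightarrow> v \<in> F \<Longrightarrow> (\<lambda>x. a * u x + b * v x) \<in> F"
    and domain_dense: "\<And>f e. f \<in> L2 M \<Longrightarrow> e > 0 \<Longrightarrow> \<exists>u\<in>F. L2_normsq M (\<lambda>x. f x - u x) < e"
    and form_sym: "\<And>u v. u \<in> F \<Longrightarrow> v \<in> F \<Longrightarrow> E u v = E v u"
    and form_lin:
      "\<And>a b u v w. u \<in> F \<Longrightarrow> v \<in> F \<Longrightarrow> w \<in> F \<Longrightarrow>
         E (\<lambda>x. a * u x + b * v x) w = a * E u w + b * E v w"
    and form_nonneg: "\<And>u. u \<in> F \<Longrightarrow> E u u \<ge> 0"
    and form_closed:
      "\<And>u :: nat \<Rightarrow> 'a \<Rightarrow> real. (\<And>n. u n \<in> F) \<Longrightarrow>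
         (\<forall>e>0. \<exists>N. \<forall>m\<ge>N. \<forall>n\<ge>N. form_normsq M E (\<lambda>x. u m x - u n x) < e) \<Longrightarrow>
         \<exists>v\<in>F. (\<lambda>n. form_normsq M E (\<lambda>x. u n x - v x)) \<longlonglongrightarrow> 0"
    and form_markov:
      "\<And>u. u \<in> F \<Longrightarrow> (\<lambda>x. min 1 (max 0 (u x))) \<in> F \<and>
         E (\<lambda>x. min 1 (max 0 (u x))) (\<lambda>x. min 1 (max 0 (u x))) \<le> E u u"

definition Cc :: "('a::topological_space \<Rightarrow> real) set" where
  "Cc = {f. continuous_on UNIV f \<and> compact (closure {x. f x \<noteq> 0})}"

definition regular_form ::
    "'a::metric_space measure \<Rightarrow> (('a \<Rightarrow> real) \<Rightarrow> ('a \<Rightarrow> real) \<Rightarrow> real) \<Rightarrow> ('a \<Rightarrow> real) set \<Rightarrow> bool" where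
  "regular_form M E F \<longleftrightarrow>
     (\<forall>u\<in>F. \<forall>e>0. \<exists>v\<in>F \<inter> Cc. form_normsq M E (\<lambda>x. u x - v x) < e) \<and>
     (\<forall>f\<in>Cc. \<forall>e>0. \<exists>v\<in>F \<inter> Cc. \<forall>x. \<bar>f x - v x\<bar> < e)"

text \<open>The support of a class of functions: the complement of the largest open set on which the
  function vanishes almost everywhere.\<close>

definition ess_support :: "'a::topological_space measure \<Rightarrow> ('a \<Rightarrow> real) \<Rightarrow> 'a set" where
  "ess_support M u = - \<Union>{U. open U \<and> (AE x in M. x \<in> U \<longrightarrow> u x = 0)}"

definition strongly_local_form ::
    "'a::metric_space measure \<Rightarrow> (('a \<Rightarrow> real) \<Rightarrow> ('a \<Rightarrow> real) \<Rightarrow> real) \<Rightarrow> ('a \<Rightarrow> real) set \<Rightarrow> bool" where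
  "strongly_local_form M E F \<longleftrightarrow>
     (\<forall>u\<in>F. \<forall>v\<in>F.
        compact (ess_support M u) \<longrightarrow> compact (ess_support M v) \<longrightarrow>
        (\<exists>U c. open U \<and> ess_support M v \<subseteq> U \<and> (AE x in M. x \<in> U \<longrightarrow> u x = c)) \<longrightarrow>
        E u v = 0)"

definition L2_semigroup :: "'a measure \<Rightarrow> (real \<Rightarrow> ('a \<Rightarrow> real) \<Rightarrow> 'a \<Rightarrow> real) \<Rightarrow> bool" where
  "L2_semigroup M P \<longleftrightarrow>
     (\<forall>t>0. \<forall>f\<in>L2 M. P t f \<in> L2 M) \<and>
     (\<forall>t>0. \<forall>f\<in>L2 M. \<forall>g\<in>L2 M. \<forall>a b.
        AE x in M. P t (\<lambda>y. a * f y + b * g y) x = a * P t f x + b * P t g x) \<and>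
     (\<forall>t>0. \<forall>f\<in>L2 M. \<forall>g\<in>L2 M. L2_inner M (P t f) g = L2_inner M f (P t g)) \<and>
     (\<forall>s>0. \<forall>t>0. \<forall>f\<in>L2 M. AE x in M. P (s + t) f x = P s (P t f) x) \<and>
     (\<forall>t>0. \<forall>f\<in>L2 M. L2_normsq M (P t f) \<le> L2_normsq M f) \<and>
     (\<forall>f\<in>L2 M. ((\<lambda>t. L2_normsq M (\<lambda>x. P t f x - f x)) \<longlongrightarrow> 0) (at_right 0))"

text \<open>\<open>u\<close> is in the domain of the infinitesimal generator of \<open>P\<close>, which maps it to \<open>h\<close>.\<close>

definition semigroup_generator ::
    "'a measure \<Rightarrow> (real \<Rightarrow> ('a \<Rightarrow> real) \<Rightarrow> 'a \<Rightarrow> real) \<Rightarrow> ('a \<Rightarrow> real) \<Rightarrow> ('a \<Rightarrow> real) \<Rightarrow> bool" where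
  "semigroup_generator M P u h \<longleftrightarrow> u \<in> L2 M \<and> h \<in> L2 M \<and>
     ((\<lambda>t. L2_normsq M (\<lambda>x. (P t u x - u x) / t - h x)) \<longlongrightarrow> 0) (at_right 0)"

text \<open>\<open>u\<close> is in the domain of the self-adjoint operator \<open>L\<close> of the form, determined by
  \<open>E(u,v) = - \<langle>L u, v\<rangle>\<close> for \<open>v \<in> F\<close>, and \<open>L u = h\<close>.\<close>

definition form_generator ::
    "'a measure \<Rightarrow> (('a \<Rightarrow> real) \<Rightarrow> ('a \<Rightarrow> real) \<Rightarrow> real) \<Rightarrow> ('a \<Rightarrow> real) set \<Rightarrow>
       ('a \<Rightarrow> real) \<Rightarrow> ('a \<Rightarrow> real) \<Rightarrow> bool" where
  "form_generator M E F u h \<longleftrightarrow> u \<in> F \<and> h \<in> L2 M \<and> (\<forall>v\<in>F. E u v = - L2_inner M h v)"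

definition heat_semigroup ::
    "'a measure \<Rightarrow> (('a \<Rightarrow> real) \<Rightarrow> ('a \<Rightarrow> real) \<Rightarrow> real) \<Rightarrow> ('a \<Rightarrow> real) set \<Rightarrow>
       (real \<Rightarrow> ('a \<Rightarrow> real) \<Rightarrow> 'a \<Rightarrow> real) \<Rightarrow> bool" where
  "heat_semigroup M E F P \<longleftrightarrow>
     L2_semigroup M P \<and> (\<forall>u h. semigroup_generator M P u h \<longleftrightarrow> form_generator M E F u h)"

definition kernel_op ::
    "'a measure \<Rightarrow> (real \<Rightarrow> 'a \<Rightarrow> 'a \<Rightarrow> real) \<Rightarrow> real \<Rightarrow> ('a \<Rightarrow> real) \<Rightarrow> 'a \<Rightarrow> real" where
  "kernel_op M p t g x = (\<integral>y. p t x y * g y \<partial>M)"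

definition continuous_heat_kernel ::
    "'a::metric_space measure \<Rightarrow> (real \<Rightarrow> ('a \<Rightarrow> real) \<Rightarrow> 'a \<Rightarrow> real) \<Rightarrow>
       (real \<Rightarrow> 'a \<Rightarrow> 'a \<Rightarrow> real) \<Rightarrow> bool" where
  "continuous_heat_kernel M P p \<longleftrightarrow>
     (\<forall>t>0. continuous_on UNIV (\<lambda>(x, y). p t x y) \<and>
        (\<forall>g\<in>L2 M. AE x in M. P t g x = kernel_op M p t g x))"

definition sub_gaussian_profile :: "real \<Rightarrow> real \<Rightarrow> real \<Rightarrow> real \<Rightarrow> real \<Rightarrow> real" where
  "sub_gaussian_profile dH dW c t r =
     t powr (- dH / dW) * exp (- c * (r powr dW / t) powr (1 / (dW - 1)))"

definition sub_gaussian_bounds ::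
    "'a::metric_space measure \<Rightarrow> (real \<Rightarrow> 'a \<Rightarrow> 'a \<Rightarrow> real) \<Rightarrow> real \<Rightarrow> real \<Rightarrow> bool" where
  "sub_gaussian_bounds M p dH dW \<longleftrightarrow>
     (\<exists>c3>0. \<exists>c4>0. \<exists>c5>0. \<exists>c6>0. \<forall>t>0. AE (x, y) in M \<Otimes>\<^sub>M M.
        c5 * sub_gaussian_profile dH dW c6 t (dist x y) \<le> p t x y \<and>
        p t x y \<le> c3 * sub_gaussian_profile dH dW c4 t (dist x y))"

locale sub_gaussian_dirichlet_space = dirichlet_form M E F
  for M :: "'a::metric_space measure" and E F +
  fixes P :: "real \<Rightarrow> ('a \<Rightarrow> real) \<Rightarrow> 'a \<Rightarrow> real"
    and p :: "real \<Rightarrow> 'a \<Rightarrow> 'a \<Rightarrow> real"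
    and dH dW :: real
  assumes locally_compact: "locally compact (UNIV :: 'a set)"
    and radon: "radon_measure M"
    and full_support: "\<And>U. open U \<Longrightarrow> U \<noteq> {} \<Longrightarrow> emeasure M U > 0"
    and ball_closure_compact: "\<And>x r. r > 0 \<Longrightarrow> compact (closure (ball x r :: 'a set))"
    and ahlfors: "ahlfors_regular M dH"
    and regular: "regular_form M E F"
    and strongly_local: "strongly_local_form M E F"
    and semigroup: "heat_semigroup M E F P"
    and heat_kernel: "continuous_heat_kernel M P p"
    and dW_gt_2: "dW > 2"
    and kernel_bounds: "sub_gaussian_bounds M p dH dW"

text \<open>On \<open>L\<^sup>\<infinity>\<close> the semigroup is given pointwise by the continuous heat kernel.\<close>

definition wBE ::
    "'a::metric_space measure \<Rightarrow> (real \<Rightarrow> 'a \<Rightarrow> 'a \<Rightarrow> real) \<Rightarrow> real \<Rightarrow> real \<Rightarrow> bool" where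
  "wBE M p dW \<kappa> \<longleftrightarrow> 0 < \<kappa> \<and> \<kappa> < dW \<and>
     (\<exists>C>0. \<forall>t>0. \<forall>g\<in>Linf M. \<forall>x y.
        ennreal \<bar>kernel_op M p t g x - kernel_op M p t g y\<bar>
          \<le> ennreal (C * (dist x y powr \<kappa> / t powr (\<kappa> / dW))) * Linf_norm M g)"

definition KS_energy ::
    "'a::metric_space measure \<Rightarrow> real \<Rightarrow> ('a \<Rightarrow> real) \<Rightarrow> real \<Rightarrow> ennreal" where
  "KS_energy M l f r =
     (\<integral>\<^sup>+x. (\<integral>\<^sup>+y\<in>{y. dist x y < r}. ennreal \<bar>f y - f x\<bar> / (ennreal (r powr l) * emeasure M (ball x r)) \<partial>M) \<partial>M)"

definition KS :: "'a::metric_space measure \<Rightarrow> real \<Rightarrow> ('a \<Rightarrow> real) set" where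
  "KS M l = {f. integrable M f \<and> Limsup (at_right 0) (KS_energy M l f) < \<infinity>}"

text \<open>The supremum is taken in the extended reals, so that it is meaningful (\<open>- \<infinity>\<close> or \<open>\<infinity>\<close>) also for
  an empty or unbounded set of exponents.\<close>

definition crit_exponent :: "'a::metric_space measure \<Rightarrow> ereal" where
  "crit_exponent M = Sup (ereal ` {l. l > 0 \<and> (\<exists>f\<in>KS M l. \<not> (\<exists>c. AE x in M. f x = c))})"

definition BV :: "'a::metric_space measure \<Rightarrow> ('a \<Rightarrow> real) set" where
  "BV M = KS M (real_of_ereal (crit_exponent M))"

definition Var :: "'a::metric_space measure \<Rightarrow> ('a \<Rightarrow> real) \<Rightarrow> ennreal" where
  "Var M f = Liminf (at_right 0) (KS_energy M (real_of_ereal (crit_exponent M)) f)"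

definition Osc :: "'a measure \<Rightarrow> ('a \<Rightarrow> real) \<Rightarrow> ennreal" where
  "Osc M f = esssup (M \<Otimes>\<^sub>M M) (\<lambda>(x, y). ennreal \<bar>f x - f y\<bar>)"

end

theory Submission
  imports Defs
begin

text \<open>
  Here \<open>\<lambda>\<^sub>1\<^sup># = d\<^sub>H\<close>, so the energy at scale \<open>r\<close> is comparable to \<open>r\<close> to the power \<open>-2 d\<^sub>H\<close> times the
  integral of \<open>\<bar>f y - f x\<bar>\<close> over \<open>\<Delta>\<^sub>r\<close>. Join two points by an \<open>r\<close>-chain of minimal length: the averages
  of \<open>f\<close> over consecutive balls of the chain differ by at most a multiple of \<open>r\<close> to the power
  \<open>-2 d\<^sub>H\<close> times the integral over the product of the two balls, and these products have bounded
  overlap, so averages over arbitrarily distant balls differ by at most a multiple of the energy.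
  The averages tend to \<open>f\<close> almost everywhere along a sequence of scales realizing the lower limit.

  Chains exist at every scale: otherwise \<open>X\<close> splits into two parts at positive distance; the upper
  heat kernel bound makes \<open>P\<^sub>t\<close> transfer between them only mass of order \<open>O(t\<^sup>3)\<close>, so composing \<open>n\<close> steps
  of length \<open>1/n\<close> shows that \<open>P\<^sub>1\<close> preserves each part, which contradicts the lower heat kernel bound.
\<close>

section \<open>Series, averages and minimal chains\<close>

text \<open>A finite sum leaves only finite terms, which reduces the claim to the real case. It
  later turns an almost everywhere finite sum of defects into pointwise convergence of
  averages.\<close>

lemma ennreal_summable_tendsto_0:
  fixes a :: "nat \<Rightarrow> ennreal"
  assumes "suminf a \<noteq> top"
  shows "a \<longlonglongrightarrow> 0"
proof -
  have fin: "a n \<noteq> top" for n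
  proof
    assume "a n = top"
    moreover have "sum a {..<Suc n} \<le> suminf a" by (intro sum_le_suminf) auto
    ultimately show False using assms by (auto simp: top_unique)
  qed
  then have eq: "a n = ennreal (enn2real (a n))" for n by (simp add: less_top)
  have "summable (\<lambda>n. enn2real (a n))"
    using assms eq by (intro summable_suminf_not_top) auto
  then have "(\<lambda>n. ennreal (enn2real (a n))) \<longlonglongrightarrow> ennreal 0"
    by (intro tendsto_ennrealI summable_LIMSEQ_zero)
  then show ?thesis using eq by simp
qed

definition avg :: "'a measure \<Rightarrow> ('a \<Rightarrow> real) \<Rightarrow> 'a set \<Rightarrow> real" where
  "avg M f S = (\<integral>x\<in>S. f x \<partial>M) / measure M S"

text \<open>The average of the constant \<open>c\<close> is \<open>c\<close>, so the difference is
  the average of \<open>f - c\<close>, and the lower bound \<open>1 / K\<close> on the measure turns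
  the division into a factor \<open>K\<close>. As \<open>c\<close> is arbitrary, it can be an
  average over another ball as well as a value of \<open>f\<close>.\<close>

lemma avg_diff_le:
  assumes f: "integrable M f" and S: "S \<in> sets M" "emeasure M S < \<infinity>"
    and K: "0 < K" "ennreal (1 / K) \<le> emeasure M S"
  shows "ennreal \<bar>avg M f S - c\<bar> \<le> ennreal K * (\<integral>\<^sup>+x\<in>S. ennreal \<bar>f x - c\<bar> \<partial>M)"
proof -
  have em: "emeasure M S = ennreal (measure M S)"
    using S(2) by (simp add: emeasure_eq_ennreal_measure)
  have mK: "1 / K \<le> measure M S"
    using K unfolding em by (simp add: ennreal_le_iff)
  then have mpos: "0 < measure M S"
    using K(1) by (smt (verit) divide_pos_pos)
  have iS: "set_integrable M S f"
    using f S unfolding set_integrable_def by (intro integrable_mult_indicator)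
  have ic: "set_integrable M S (\<lambda>_. c)"
    using S by (simp add: set_integrable_def)
  have id: "set_integrable M S (\<lambda>x. f x - c)"
    using set_integral_diff(1)[OF iS ic] .
  then have ia: "set_integrable M S (\<lambda>x. \<bar>f x - c\<bar>)"
    by (rule set_integrable_abs)
  have "avg M f S - c = (\<integral>x\<in>S. f x - c \<partial>M) / measure M S"
    using mpos S set_integral_diff(2)[OF iS ic]
    by (simp add: avg_def diff_divide_distrib set_lebesgue_integral_def)
  then have "\<bar>avg M f S - c\<bar> = \<bar>\<integral>x\<in>S. f x - c \<partial>M\<bar> / measure M S"
    using mpos by simp
  also have "\<dots> \<le> (\<integral>x\<in>S. \<bar>f x - c\<bar> \<partial>M) / measure M S"
    using mpos set_integral_norm_bound[OF id] by (simp add: divide_right_mono)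
  also have "\<dots> \<le> K * (\<integral>x\<in>S. \<bar>f x - c\<bar> \<partial>M)"
  proof -
    have "1 / measure M S \<le> K" using mK mpos K(1) by (simp add: field_simps)
    moreover have "0 \<le> (\<integral>x\<in>S. \<bar>f x - c\<bar> \<partial>M)"
      by (simp add: set_lebesgue_integral_def integral_nonneg_AE)
    ultimately show ?thesis
      using mult_right_mono by fastforce
  qed
  finally have "ennreal \<bar>avg M f S - c\<bar> \<le> ennreal K * ennreal (\<integral>x\<in>S. \<bar>f x - c\<bar> \<partial>M)"
    using K(1) by (simp add: ennreal_mult'[symmetric] ennreal_leI)
  also have "ennreal (\<integral>x\<in>S. \<bar>f x - c\<bar> \<partial>M) = (\<integral>\<^sup>+x\<in>S. ennreal \<bar>f x - c\<bar> \<partial>M)"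
    using ia unfolding set_lebesgue_integral_def set_integrable_def
    by (subst nn_integral_eq_integral[symmetric])
       (auto intro!: nn_integral_cong split: split_indicator)
  finally show ?thesis .
qed

lemma relpow_segment:
  assumes "\<And>i. i < N \<Longrightarrow> (q i, q (Suc i)) \<in> R" "a \<le> b" "b \<le> N"
  shows "(q a, q b) \<in> R ^^ (b - a)"
  unfolding relpow_fun_conv
  using assms by (intro exI[of _ "\<lambda>i. q (a + i)"]) auto

text \<open>A path of least length has no shortcuts: an edge from \<open>q i\<close> to
  \<open>q j\<close> that skips a vertex would give a path of length \<open>i + 1 + (N - j)\<close>,
  which is less than \<open>N\<close>.\<close>

lemma minimal_chain:
  assumes "(x, y) \<in> R\<^sup>*"
  obtains N and q :: "nat \<Rightarrow> 'a" where "q 0 = x" "q N = y"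
    "\<And>i. i < N \<Longrightarrow> (q i, q (Suc i)) \<in> R"
    "\<And>i j. Suc i < j \<Longrightarrow> j \<le> N \<Longrightarrow> (q i, q j) \<notin> R"
proof -
  define N where "N = (LEAST n. (x, y) \<in> R ^^ n)"
  obtain n0 where n0: "(x, y) \<in> R ^^ n0"
    using assms rtrancl_imp_relpow by blast
  have N: "(x, y) \<in> R ^^ N" unfolding N_def by (rule LeastI[of _ n0], fact n0)
  have min: "n < N \<Longrightarrow> (x, y) \<notin> R ^^ n" for n
    unfolding N_def by (rule not_less_Least)
  obtain q where q: "q 0 = x" "q N = y" "\<And>i. i < N \<Longrightarrow> (q i, q (Suc i)) \<in> R"
    using N unfolding relpow_fun_conv by blast
  have "(q i, q j) \<notin> R" if "Suc i < j" "j \<le> N" for i j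
  proof
    assume "(q i, q j) \<in> R"
    then have "(q i, q j) \<in> R ^^ 1" by simp
    moreover have "(q 0, q i) \<in> R ^^ i" "(q j, q N) \<in> R ^^ (N - j)"
      using relpow_segment[of N q R 0 i] relpow_segment[of N q R j N] q that by auto
    ultimately have "(q 0, q N) \<in> R ^^ (i + (1 + (N - j)))"
      unfolding relpow_add by (blast intro: relcompI)
    moreover have "i + (1 + (N - j)) < N" using that by auto
    ultimately show False using min[of "i + (1 + (N - j))"] q(1,2) by (simp del: relpow.simps add_Suc_right)
  qed
  with q that show thesis by blast
qed

text \<open>Taking \<open>i\<close> to be the minimum leaves only two candidates. The set will
  consist of the indices at which a given pair of points lies in consecutive balls of a
  chain.\<close>

lemma card_le_2_if_close:
  fixes S :: "nat set"
  assumes "finite S" "\<And>i j. i \<in> S \<Longrightarrow> j \<in> S \<Longrightarrow> j \<le> Suc i"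
  shows "card S \<le> 2"
proof (cases "S = {}")
  case False
  have "S \<subseteq> {Min S, Suc (Min S)}"
  proof
    fix j assume "j \<in> S"
    then have "Min S \<le> j" "j \<le> Suc (Min S)"
      using assms False by (auto intro!: assms(2) Min_in)
    then show "j \<in> {Min S, Suc (Min S)}" by auto
  qed
  from card_mono[OF _ this] show ?thesis by (auto simp: card_insert_if split: if_splits)
qed auto

section \<open>Ahlfors regular spaces: measurability of the distance and the chain estimate\<close>

text \<open>The regularity constants are parameters, so that the final constant can be an explicit
  expression in them that does not depend on the function.\<close>

locale ahlfors_space =
  fixes M :: "'a::metric_space measure" and d c1 c2 :: real
  assumes sets_M [measurable_cong]: "sets M = sets borel"
    and relatively_compact_ball: "\<And>x r. 0 < r \<Longrightarrow> compact (closure (ball x r :: 'a set))"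
    and d_pos: "0 < d" and c1_pos: "0 < c1" and c2_pos: "0 < c2"
    and ball_lower: "\<And>x r. 0 \<le> r \<Longrightarrow> ennreal (c1 * r powr d) \<le> emeasure M (ball x r)"
    and ball_upper: "\<And>x r. 0 \<le> r \<Longrightarrow> emeasure M (ball x r) \<le> ennreal (c2 * r powr d)"
begin

lemma space_M [simp]: "space M = UNIV"
  using sets_eq_imp_space_eq[OF sets_M] by simp

lemma ball_in_sets [measurable]: "ball x r \<in> sets M"
  by (simp add: sets_M)

lemma emeasure_ball_finite: "emeasure M (ball x r) < \<infinity>"
proof (cases "0 \<le> r")
  case True
  from ball_upper[OF this, of x] show ?thesis by (auto simp: less_top[symmetric] top_unique)
next
  case False
  then have "ball x r = {}" by simp
  then show ?thesis by (simp only: emeasure_empty) simp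
qed

sublocale sigma_finite_measure M
proof
  fix x0 :: 'a
  show "\<exists>A. countable A \<and> A \<subseteq> sets M \<and> \<Union> A = space M \<and> (\<forall>a\<in>A. emeasure M a \<noteq> \<infinity>)"
  proof (intro exI conjI ballI)
    show "countable (range (\<lambda>n::nat. ball x0 (real n)))" by simp
    show "\<Union> (range (\<lambda>n::nat. ball x0 (real n))) = space M"
      by (auto intro: reals_Archimedean2)
  qed (use emeasure_ball_finite in \<open>auto simp: top.not_eq_extremum\<close>)
qed

sublocale pair: pair_sigma_finite M M ..

text \<open>Balls have compact closure and are therefore totally bounded; the union of finite nets
  over all integer radii and all mesh sizes \<open>1 / Suc m\<close> is countable and dense.\<close>

lemma separable: "\<exists>D :: 'a set. countable D \<and> (\<forall>x. \<forall>e>0. \<exists>q\<in>D. dist x q < e)"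
proof -
  fix x0 :: 'a
  have "\<exists>k. finite k \<and> ball x0 (real (Suc n)) \<subseteq> (\<Union>x\<in>k. ball x (1 / real (Suc m)))" for n m
  proof -
    have "seq_compact (closure (ball x0 (real (Suc n))))"
      by (intro compact_imp_seq_compact relatively_compact_ball) simp
    from seq_compact_imp_totally_bounded[OF this, rule_format, of "1 / real (Suc m)"]
    obtain k where k: "finite k" "closure (ball x0 (real (Suc n))) \<subseteq> (\<Union>x\<in>k. ball x (1 / real (Suc m)))"
      by fastforce
    show ?thesis
      by (rule exI[of _ k], rule conjI, rule k(1), rule order_trans[OF closure_subset k(2)])
  qed
  then obtain k where k: "\<And>n m. finite (k n m)"
      "\<And>n m. ball x0 (real (Suc n)) \<subseteq> (\<Union>x\<in>k n m. ball x (1 / real (Suc m)))"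
    by metis
  show ?thesis
  proof (intro exI[of _ "\<Union>n. \<Union>m. k n m"] conjI allI impI)
    show "countable (\<Union>n. \<Union>m. k n m)"
      using k(1) by (simp add: countable_finite)
    fix x :: 'a and e :: real assume e: "0 < e"
    obtain n where n: "dist x0 x < real n" using reals_Archimedean2 by blast
    obtain m where m: "1 / real (Suc m) < e" using nat_approx_posE[OF e] by blast
    have "x \<in> ball x0 (real (Suc n))" using n by simp
    then obtain q where "q \<in> k n m" "dist q x < 1 / real (Suc m)"
      using k(2)[of n m] by auto
    then show "\<exists>q\<in>\<Union>n. \<Union>m. k n m. dist x q < e"
      using m by (intro bexI[of _ q]) (auto simp: dist_commute)
  qed
qed

text \<open>Measurability refers to the product sigma-algebra. A countable dense set
  \<open>D\<close> makes the distance a countable infimum of sums of functions of one variable, each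
  measurable in its own coordinate.\<close>

lemma measurable_dist_pair [measurable]: "(\<lambda>(x, y). dist x y) \<in> borel_measurable (M \<Otimes>\<^sub>M M)"
proof -
  obtain D :: "'a set" where D: "countable D" "\<And>x e. 0 < e \<Longrightarrow> \<exists>q\<in>D. dist x q < e"
    using separable by blast
  have D0: "D \<noteq> {}" using D(2)[of 1] by auto
  have meas: "(\<lambda>x. dist x q) \<in> borel_measurable M" for q :: 'a
    unfolding measurable_cong_sets[OF sets_M refl]
    by (intro borel_measurable_continuous_onI continuous_intros)
  have "dist x y = (INF q\<in>D. dist x q + dist y q)" for x y
  proof (rule antisym)
    show "dist x y \<le> (INF q\<in>D. dist x q + dist y q)"
      using D0 by (intro cINF_greatest) (auto simp: dist_triangle2)
    show "(INF q\<in>D. dist x q + dist y q) \<le> dist x y"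
    proof (rule field_le_epsilon)
      fix e :: real assume "0 < e"
      then obtain q where q: "q \<in> D" "dist x q < e / 2" using D(2)[of "e/2" x] by auto
      have "(INF q\<in>D. dist x q + dist y q) \<le> dist x q + dist y q"
        using q(1) by (intro cINF_lower bdd_belowI[of _ 0]) auto
      also have "\<dots> \<le> dist x y + e"
        using q(2) dist_triangle[of y q x] by (simp add: dist_commute)
      finally show "(INF q\<in>D. dist x q + dist y q) \<le> dist x y + e" .
    qed
  qed
  then have "(\<lambda>(x, y). dist x y) = (\<lambda>z. INF q\<in>D. dist (fst z) q + dist (snd z) q)"
    unfolding case_prod_unfold by (rule ext)
  also have "\<dots> \<in> borel_measurable (M \<Otimes>\<^sub>M M)"
    by (intro borel_measurable_cINF_real D(1) borel_measurable_add
        measurable_compose[OF measurable_fst meas] measurable_compose[OF measurable_snd meas])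
  finally show ?thesis .
qed

lemma measurable_dist [measurable (raw)]:
  assumes [measurable]: "f \<in> N \<rightarrow>\<^sub>M M" "g \<in> N \<rightarrow>\<^sub>M M"
  shows "(\<lambda>x. dist (f x) (g x)) \<in> borel_measurable N"
  using measurable_compose[OF measurable_Pair[OF assms] measurable_dist_pair]
  unfolding prod.case .

text \<open>Two consecutive balls of a chain of minimal length may meet, but no others, so the products
  of consecutive balls overlap at most twice.\<close>

lemma avg_chain_le:
  fixes f :: "'a \<Rightarrow> real"
  assumes f: "integrable M f" and r: "0 < r"
    and chain: "(x, y) \<in> {(a, b). dist a b < r}\<^sup>*"
  shows "ennreal \<bar>avg M f (ball y (r / 2)) - avg M f (ball x (r / 2))\<bar>
    \<le> ennreal (2 / (c1 * (r / 2) powr d)\<^sup>2) *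
       (\<integral>\<^sup>+a. (\<integral>\<^sup>+b\<in>{b. dist a b < 2 * r}. ennreal \<bar>f b - f a\<bar> \<partial>M) \<partial>M)"
proof -
  define K where "K = 1 / (c1 * (r / 2) powr d)"
  have K: "0 < K" using r c1_pos by (simp add: K_def)
  have [measurable]: "f \<in> borel_measurable M" using f by simp
  obtain N q where q: "q 0 = x" "q N = y" "\<And>i. i < N \<Longrightarrow> dist (q i) (q (Suc i)) < r"
    "\<And>i j. Suc i < j \<Longrightarrow> j \<le> N \<Longrightarrow> r \<le> dist (q i) (q j)"
  proof (rule minimal_chain[OF chain])
    fix N and q :: "nat \<Rightarrow> 'a"
    assume "q 0 = x" "q N = y" "\<And>i. i < N \<Longrightarrow> (q i, q (Suc i)) \<in> {(a, b). dist a b < r}"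
      "\<And>i j. Suc i < j \<Longrightarrow> j \<le> N \<Longrightarrow> (q i, q j) \<notin> {(a, b). dist a b < r}"
    then show thesis by (intro that[of q N]) (simp_all add: not_less)
  qed
  define B where "B i = ball (q i) (r / 2)" for i
  have [measurable]: "B i \<in> sets M" for i by (simp add: B_def)
  define m where "m i = avg M f (B i)" for i
  have Bfin: "emeasure M (B i) < \<infinity>" for i unfolding B_def by (rule emeasure_ball_finite)
  have Blow: "ennreal (1 / K) \<le> emeasure M (B i)" for i
    using ball_lower[of "r/2" "q i"] r by (simp add: K_def B_def)
  \<comment> \<open>\<open>avg_diff_le\<close> is used twice: with the average over the next ball as
    the constant, then, for each \<open>a\<close>, with \<open>f a\<close> as the constant. Each use
    costs a factor \<open>K\<close>.\<close>
  have step: "ennreal \<bar>m (Suc i) - m i\<bar> \<le>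
      ennreal (K\<^sup>2) * (\<integral>\<^sup>+a. (\<integral>\<^sup>+b. indicator (B i) a * indicator (B (Suc i)) b * ennreal \<bar>f b - f a\<bar> \<partial>M) \<partial>M)"
    (is "_ \<le> _ * ?I") for i
  proof -
    have "ennreal \<bar>m i - m (Suc i)\<bar> \<le> ennreal K * (\<integral>\<^sup>+a\<in>B i. ennreal \<bar>f a - m (Suc i)\<bar> \<partial>M)"
      unfolding m_def by (rule avg_diff_le[OF f _ Bfin K Blow]) simp
    also have "\<dots> \<le> ennreal K * (\<integral>\<^sup>+a\<in>B i. ennreal K * (\<integral>\<^sup>+b\<in>B (Suc i). ennreal \<bar>f b - f a\<bar> \<partial>M) \<partial>M)"
    proof (intro mult_left_mono nn_integral_mono mult_right_mono)
      fix a
      show "ennreal \<bar>f a - m (Suc i)\<bar> \<le> ennreal K * (\<integral>\<^sup>+b\<in>B (Suc i). ennreal \<bar>f b - f a\<bar> \<partial>M)"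
        using avg_diff_le[OF f _ Bfin K Blow, of "Suc i" "f a"] unfolding m_def
        by (simp add: abs_minus_commute)
    qed auto
    also have "\<dots> = ennreal K * (ennreal K * ?I)"
    proof -
      have "(\<integral>\<^sup>+a\<in>B i. ennreal K * (\<integral>\<^sup>+b\<in>B (Suc i). ennreal \<bar>f b - f a\<bar> \<partial>M) \<partial>M)
          = (\<integral>\<^sup>+a. ennreal K * (\<integral>\<^sup>+b. indicator (B i) a * indicator (B (Suc i)) b * ennreal \<bar>f b - f a\<bar> \<partial>M) \<partial>M)"
        by (intro nn_integral_cong) (simp add: mult_ac split: split_indicator)
      also have "\<dots> = ennreal K * ?I"
        by (rule nn_integral_cmult) measurable
      finally show ?thesis by simp
    qed
    finally show ?thesis
      using K by (simp add: abs_minus_commute power2_eq_square ennreal_mult mult.assoc)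
  qed
  have overlap: "(\<Sum>i<N. indicator (B i) a * indicator (B (Suc i)) b :: ennreal)
      \<le> 2 * indicator {b. dist a b < 2 * r} b" for a b
  proof -
    define S where "S = {i. i < N \<and> a \<in> B i \<and> b \<in> B (Suc i)}"
    have fin: "finite S" by (auto simp: S_def)
    have eq: "(\<Sum>i<N. indicator (B i) a * indicator (B (Suc i)) b :: ennreal) = of_nat (card S)"
    proof -
      have "(\<Sum>i<N. indicator (B i) a * indicator (B (Suc i)) b :: ennreal)
          = (\<Sum>i<N. if i \<in> S then 1 else 0)"
        by (intro sum.cong) (auto simp: S_def indicator_def)
      also have "\<dots> = (\<Sum>i\<in>{i. i < N} \<inter> S. 1)"
        by (subst sum.inter_restrict) (auto simp: lessThan_def)
      also have "{i. i < N} \<inter> S = S" by (auto simp: S_def)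
      finally show ?thesis by simp
    qed
    show ?thesis
    proof (cases "S = {}")
      case False
      then obtain i where i: "i \<in> S" by auto
      have "card S \<le> 2"
      proof (rule card_le_2_if_close[OF fin])
        fix i j assume ij: "i \<in> S" "j \<in> S"
        show "j \<le> Suc i"
        proof (rule ccontr)
          assume "\<not> j \<le> Suc i"
          then have "r \<le> dist (q i) (q j)" using q(4)[of i j] ij by (auto simp: S_def)
          also have "\<dots> < r"
            using dist_triangle[of "q i" "q j" a] ij by (auto simp: S_def B_def dist_commute)
          finally show False by simp
        qed
      qed
      \<comment> \<open>Less than \<open>r / 2\<close> from \<open>a\<close> to its centre, less
        than \<open>r\<close> between the centres, less than \<open>r / 2\<close> to
        \<open>b\<close>.\<close>
      moreover have "dist a b < 2 * r"
        using i q(3)[of i] dist_triangle[of a b "q i"] dist_triangle[of "q i" b "q (Suc i)"]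
        by (auto simp: S_def B_def dist_commute)
      ultimately show ?thesis
        unfolding eq using of_nat_mono[of "card S" 2, where 'a=ennreal] by simp
    qed (simp add: eq)
  qed
  have "ennreal \<bar>m N - m 0\<bar> \<le> (\<Sum>i<N. ennreal \<bar>m (Suc i) - m i\<bar>)"
  proof -
    have "m N - m 0 = (\<Sum>i<N. m (Suc i) - m i)" by (simp add: sum_lessThan_telescope)
    then have "\<bar>m N - m 0\<bar> \<le> (\<Sum>i<N. \<bar>m (Suc i) - m i\<bar>)"
      using sum_abs by metis
    then show ?thesis by (simp add: ennreal_leI)
  qed
  also have "\<dots> \<le> (\<Sum>i<N. ennreal (K\<^sup>2) *
      (\<integral>\<^sup>+a. (\<integral>\<^sup>+b. indicator (B i) a * indicator (B (Suc i)) b * ennreal \<bar>f b - f a\<bar> \<partial>M) \<partial>M))"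
    by (intro sum_mono step)
  also have "\<dots> = ennreal (K\<^sup>2) *
      (\<integral>\<^sup>+a. (\<integral>\<^sup>+b. (\<Sum>i<N. indicator (B i) a * indicator (B (Suc i)) b) * ennreal \<bar>f b - f a\<bar> \<partial>M) \<partial>M)"
  proof -
    have "(\<Sum>i<N. \<integral>\<^sup>+a. (\<integral>\<^sup>+b. indicator (B i) a * indicator (B (Suc i)) b * ennreal \<bar>f b - f a\<bar> \<partial>M) \<partial>M)
        = (\<integral>\<^sup>+a. (\<Sum>i<N. \<integral>\<^sup>+b. indicator (B i) a * indicator (B (Suc i)) b * ennreal \<bar>f b - f a\<bar> \<partial>M) \<partial>M)"
      by (rule nn_integral_sum[symmetric]) measurable
    also have "\<dots> = (\<integral>\<^sup>+a. (\<integral>\<^sup>+b. (\<Sum>i<N. indicator (B i) a * indicator (B (Suc i)) b) * ennreal \<bar>f b - f a\<bar> \<partial>M) \<partial>M)"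
      unfolding sum_distrib_right
      by (intro nn_integral_cong nn_integral_sum[symmetric]) measurable
    finally show ?thesis by (simp only: sum_distrib_left[symmetric])
  qed
  also have "\<dots> \<le> ennreal (K\<^sup>2) *
      (\<integral>\<^sup>+a. (\<integral>\<^sup>+b. (2 * indicator {b. dist a b < 2 * r} b) * ennreal \<bar>f b - f a\<bar> \<partial>M) \<partial>M)"
    by (intro mult_left_mono nn_integral_mono mult_right_mono overlap) auto
  also have "\<dots> = ennreal (K\<^sup>2) * (2 *
      (\<integral>\<^sup>+a. (\<integral>\<^sup>+b\<in>{b. dist a b < 2 * r}. ennreal \<bar>f b - f a\<bar> \<partial>M) \<partial>M))"
  proof -
    have "(\<integral>\<^sup>+a. (\<integral>\<^sup>+b. (2 * indicator {b. dist a b < 2 * r} b) * ennreal \<bar>f b - f a\<bar> \<partial>M) \<partial>M)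
        = (\<integral>\<^sup>+a. 2 * (\<integral>\<^sup>+b\<in>{b. dist a b < 2 * r}. ennreal \<bar>f b - f a\<bar> \<partial>M) \<partial>M)"
    proof (intro nn_integral_cong)
      fix a
      have "(\<integral>\<^sup>+b. (2 * indicator {b. dist a b < 2 * r} b) * ennreal \<bar>f b - f a\<bar> \<partial>M)
          = (\<integral>\<^sup>+b. 2 * (ennreal \<bar>f b - f a\<bar> * indicator {b. dist a b < 2 * r} b) \<partial>M)"
        by (simp add: mult_ac)
      also have "\<dots> = 2 * (\<integral>\<^sup>+b\<in>{b. dist a b < 2 * r}. ennreal \<bar>f b - f a\<bar> \<partial>M)"
        by (rule nn_integral_cmult) measurable
      finally show "(\<integral>\<^sup>+b. (2 * indicator {b. dist a b < 2 * r} b) * ennreal \<bar>f b - f a\<bar> \<partial>M) = \<dots>" .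
    qed
    also have "\<dots> = 2 * (\<integral>\<^sup>+a. (\<integral>\<^sup>+b\<in>{b. dist a b < 2 * r}. ennreal \<bar>f b - f a\<bar> \<partial>M) \<partial>M)"
      by (rule nn_integral_cmult) measurable
    finally show ?thesis by simp
  qed
  also have "\<dots> = ennreal (2 * K\<^sup>2) *
      (\<integral>\<^sup>+a. (\<integral>\<^sup>+b\<in>{b. dist a b < 2 * r}. ennreal \<bar>f b - f a\<bar> \<partial>M) \<partial>M)"
    using ennreal_mult[of 2 "K\<^sup>2"] by (simp add: mult_ac)
  finally show ?thesis
    by (simp add: m_def B_def q(1,2) K_def power_divide)
qed

section \<open>The energy at exponent \<open>d\<close>, oscillation and boundedness\<close>

lemma measurable_emeasure_ball [measurable]: "(\<lambda>x. emeasure M (ball x r)) \<in> borel_measurable M"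
proof -
  have "emeasure M (ball x r) = (\<integral>\<^sup>+y. indicator {y. dist x y < r} y \<partial>M)" for x
    by (simp add: ball_def[symmetric])
  then show ?thesis by simp
qed

text \<open>The upper volume bound makes the denominator in the energy at most
  \<open>c2 * (R powr d)\<^sup>2\<close>, so multiplying by this constant removes the
  denominator.\<close>

lemma variation_le_KS_energy:
  assumes [measurable]: "f \<in> borel_measurable M" and R: "0 < R"
  shows "(\<integral>\<^sup>+x. (\<integral>\<^sup>+y\<in>{y. dist x y < R}. ennreal \<bar>f y - f x\<bar> \<partial>M) \<partial>M)
    \<le> ennreal (c2 * (R powr d)\<^sup>2) * KS_energy M d f R"
proof -
  define L where "L = ennreal (c2 * (R powr d)\<^sup>2)"
  have bound: "u \<le> L * (u / (ennreal (R powr d) * emeasure M (ball x R)))" for u x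
  proof -
    define w where "w = ennreal (R powr d) * emeasure M (ball x R)"
    have "w \<le> ennreal (R powr d) * ennreal (c2 * R powr d)"
      unfolding w_def using ball_upper[of R x] R by (intro mult_left_mono) auto
    also have "\<dots> = L"
      unfolding L_def using R c2_pos
      by (subst ennreal_mult[symmetric]) (auto simp: power2_eq_square mult_ac)
    finally have wL: "w \<le> L" .
    \<comment> \<open>In \<open>ennreal\<close>, cancelling \<open>w\<close> requires it to be
      neither zero nor infinite; the lower volume bound excludes zero.\<close>
    have "0 < ennreal (c1 * R powr d)" using R c1_pos by (simp add: ennreal_zero_less_mult_iff)
    then have "0 < emeasure M (ball x R)" using ball_lower[of R x] R by (meson less_le_trans less_imp_le)
    then have w0: "w \<noteq> 0" unfolding w_def using R by (auto simp: ennreal_zero_less_mult_iff)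
    have wtop: "w \<noteq> top" using wL by (auto simp: L_def top_unique)
    have "u = w * (u / w)" using w0 wtop by (metis ennreal_mult_divide_eq ennreal_times_divide mult.commute)
    also have "\<dots> \<le> L * (u / w)" by (intro mult_right_mono wL) auto
    finally show ?thesis by (simp add: w_def)
  qed
  have "(\<integral>\<^sup>+x. (\<integral>\<^sup>+y\<in>{y. dist x y < R}. ennreal \<bar>f y - f x\<bar> \<partial>M) \<partial>M)
    \<le> (\<integral>\<^sup>+x. (\<integral>\<^sup>+y. L * (ennreal \<bar>f y - f x\<bar> / (ennreal (R powr d) * emeasure M (ball x R))
          * indicator {y. dist x y < R} y) \<partial>M) \<partial>M)"
    unfolding mult.assoc[symmetric] by (intro nn_integral_mono mult_right_mono bound) auto
  also have "\<dots> = (\<integral>\<^sup>+x. L * (\<integral>\<^sup>+y\<in>{y. dist x y < R}. ennreal \<bar>f y - f x\<bar>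
        / (ennreal (R powr d) * emeasure M (ball x R)) \<partial>M) \<partial>M)"
    by (intro nn_integral_cong nn_integral_cmult) measurable
  also have "\<dots> = L * KS_energy M d f R"
    unfolding KS_energy_def by (rule nn_integral_cmult) measurable
  finally show ?thesis by (simp add: L_def)
qed

text \<open>The product of \<open>2 / (c1 * (R / 4) powr d)\<^sup>2\<close> from the chain estimate
  and \<open>c2 * (R powr d)\<^sup>2\<close> from the energy denominator; the powers of
  \<open>R\<close> cancel.\<close>

definition osc_const :: real where
  "osc_const = 2 * c2 * (4 powr d)\<^sup>2 / c1\<^sup>2"

lemma osc_const_pos: "0 < osc_const"
  using c1_pos c2_pos by (simp add: osc_const_def)

text \<open>The chain has steps below \<open>R / 2\<close> and balls of radius \<open>R / 4\<close>,
  so pairs from consecutive balls are less than \<open>R\<close> apart and the energy at scale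
  \<open>R\<close> sees them. With energy exponent \<open>d\<close> the constant is independent of
  the scale and of the distance from \<open>x\<close> to \<open>y\<close>.\<close>

lemma avg_osc_le:
  assumes f: "integrable M f" and R: "0 < R"
    and chain: "(x, y) \<in> {(a, b). dist a b < R / 2}\<^sup>*"
  shows "ennreal \<bar>avg M f (ball y (R / 4)) - avg M f (ball x (R / 4))\<bar>
    \<le> ennreal osc_const * KS_energy M d f R"
proof -
  have "ennreal \<bar>avg M f (ball y (R / 4)) - avg M f (ball x (R / 4))\<bar>
      \<le> ennreal (2 / (c1 * (R / 4) powr d)\<^sup>2) *
       (\<integral>\<^sup>+a. (\<integral>\<^sup>+b\<in>{b. dist a b < R}. ennreal \<bar>f b - f a\<bar> \<partial>M) \<partial>M)"
    using avg_chain_le[OF f _ chain] R by simp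
  also have "\<dots> \<le> ennreal (2 / (c1 * (R / 4) powr d)\<^sup>2) * (ennreal (c2 * (R powr d)\<^sup>2) * KS_energy M d f R)"
    using f R by (intro mult_left_mono variation_le_KS_energy) auto
  also have "\<dots> = ennreal osc_const * KS_energy M d f R"
  proof -
    have "2 / (c1 * (R / 4) powr d)\<^sup>2 * (c2 * (R powr d)\<^sup>2) = osc_const"
      using R c1_pos by (simp add: osc_const_def powr_divide power_divide power_mult_distrib field_simps)
    then show ?thesis
      using R c1_pos c2_pos by (simp add: ennreal_mult'[symmetric] mult.assoc[symmetric])
  qed
  finally show ?thesis .
qed

text \<open>The defect at a point involves a single average, so only one factor of order
  \<open>R powr (- d)\<close> meets \<open>R powr (2 * d)\<close>. A factor \<open>R powr d\<close>
  remains and makes the integrated defect small as long as the energy stays bounded. The measurable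
  majorant \<open>g\<close> stands in for the defect, whose own measurability is thereby left
  aside.\<close>

lemma avg_defect_le:
  assumes f: "integrable M f" and R: "0 < R"
  obtains g where "g \<in> borel_measurable M" "\<And>x. ennreal \<bar>avg M f (ball x (R / 4)) - f x\<bar> \<le> g x"
    "(\<integral>\<^sup>+x. g x \<partial>M) \<le> ennreal (c2 * 4 powr d / c1 * R powr d) * KS_energy M d f R"
proof
  have [measurable]: "f \<in> borel_measurable M" using f by simp
  define K where "K = 1 / (c1 * (R / 4) powr d)"
  have K: "0 < K" using R c1_pos by (simp add: K_def)
  define g where "g x = ennreal K * (\<integral>\<^sup>+y\<in>{y. dist x y < R / 4}. ennreal \<bar>f y - f x\<bar> \<partial>M)" for x
  show "g \<in> borel_measurable M" unfolding g_def by measurable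
  show "ennreal \<bar>avg M f (ball x (R / 4)) - f x\<bar> \<le> g x" for x
    unfolding g_def using avg_diff_le[OF f ball_in_sets emeasure_ball_finite K, of x "R/4" "f x"]
      ball_lower[of "R/4" x] R by (simp add: K_def ball_def)
  have "(\<integral>\<^sup>+x. g x \<partial>M) = ennreal K * (\<integral>\<^sup>+x. (\<integral>\<^sup>+y\<in>{y. dist x y < R / 4}. ennreal \<bar>f y - f x\<bar> \<partial>M) \<partial>M)"
    unfolding g_def by (rule nn_integral_cmult) measurable
  also have "\<dots> \<le> ennreal K * (\<integral>\<^sup>+x. (\<integral>\<^sup>+y\<in>{y. dist x y < R}. ennreal \<bar>f y - f x\<bar> \<partial>M) \<partial>M)"
    using R by (intro mult_left_mono nn_integral_mono) (auto split: split_indicator)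
  also have "\<dots> \<le> ennreal K * (ennreal (c2 * (R powr d)\<^sup>2) * KS_energy M d f R)"
    using R by (intro mult_left_mono variation_le_KS_energy) auto
  also have "\<dots> = ennreal (c2 * 4 powr d / c1 * R powr d) * KS_energy M d f R"
  proof -
    have "K * (c2 * (R powr d)\<^sup>2) = c2 * 4 powr d / c1 * R powr d"
      using R c1_pos by (simp add: K_def powr_divide power2_eq_square)
    then show ?thesis
      using K c2_pos by (simp add: ennreal_mult'[symmetric] mult.assoc[symmetric])
  qed
  finally show "(\<integral>\<^sup>+x. g x \<partial>M) \<le> ennreal (c2 * 4 powr d / c1 * R powr d) * KS_energy M d f R" .
qed

text \<open>Energies below \<open>W + e\<close> occur at arbitrarily small radii by definition of
  the lower limit, whereas \<open>R powr d * (W + e)\<close> is small for all small radii; some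
  radius satisfies both.\<close>

lemma good_radius:
  assumes W: "Liminf (at_right 0) (KS_energy M d f) = ennreal W" "0 \<le> W" and e: "0 < e"
  shows "\<exists>R>0. KS_energy M d f R \<le> ennreal (W + e)
    \<and> ennreal (c2 * 4 powr d / c1 * R powr d) * KS_energy M d f R \<le> ennreal e"
proof -
  define c where "c = c2 * 4 powr d / c1"
  have c: "0 < c" using c1_pos c2_pos by (simp add: c_def)
  have "((\<lambda>R. c * R powr d * (W + e)) \<longlongrightarrow> c * 0 * (W + e)) (at_right 0)"
    using d_pos
    by (intro tendsto_intros tendsto_zero_powrI[where b=d] eventually_mono[OF eventually_at_right_less]) auto
  then have "((\<lambda>R. c * R powr d * (W + e)) \<longlongrightarrow> 0) (at_right 0)" by simp
  then have "\<forall>\<^sub>F R in at_right 0. c * R powr d * (W + e) < e"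
    using e by (rule order_tendstoD(2))
  then have ev: "\<forall>\<^sub>F R in at_right 0. 0 < R \<and> c * R powr d * (W + e) < e"
    using eventually_at_right_less[of "0::real"] by eventually_elim auto
  have "\<exists>\<^sub>F R in at_right 0. KS_energy M d f R < ennreal (W + e)"
  proof (rule ccontr)
    assume "\<not> ?thesis"
    then have "\<forall>\<^sub>F R in at_right 0. ennreal (W + e) \<le> KS_energy M d f R"
      by (simp add: not_frequently not_less)
    then have "ennreal (W + e) \<le> ennreal W"
      unfolding W(1)[symmetric] by (rule Liminf_bounded)
    then show False using W e by (simp add: ennreal_le_iff)
  qed
  from frequently_ex[OF frequently_eventually_conj[OF this ev]]
  obtain R where R: "0 < R" "c * R powr d * (W + e) < e" "KS_energy M d f R < ennreal (W + e)"
    by auto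
  have "ennreal (c * R powr d) * KS_energy M d f R \<le> ennreal (c * R powr d) * ennreal (W + e)"
    using R(3) by (intro mult_left_mono) auto
  also have "\<dots> \<le> ennreal e"
    using R(2) c W e by (subst ennreal_mult[symmetric]) (auto intro!: ennreal_leI simp del: ennreal_plus)
  finally show ?thesis using R(1,3) by (auto simp: c_def intro!: exI[of _ R])
qed

text \<open>Along radii \<open>R k\<close> the defects have integrals at most
  \<open>(1 / 2) ^ k\<close>, so their sum is finite almost everywhere and the averages converge to
  \<open>f\<close> there. The oscillation bound for averages then passes to the limit. A single set
  \<open>G\<close> serving all pairs gives both boundedness and the bound on the product
  space.\<close>

lemma AE_diff_le:
  assumes chain: "\<And>r x y. 0 < r \<Longrightarrow> (x, y) \<in> {(a, b :: 'a). dist a b < r}\<^sup>*"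
    and f: "integrable M f"
    and W: "Liminf (at_right 0) (KS_energy M d f) = ennreal W" "0 \<le> W"
  shows "\<exists>G. (AE x in M. x \<in> G) \<and> (\<forall>x\<in>G. \<forall>y\<in>G. \<bar>f x - f y\<bar> \<le> osc_const * W)"
proof -
  have "\<exists>R>0. KS_energy M d f R \<le> ennreal (W + (1 / 2) ^ k)
      \<and> ennreal (c2 * 4 powr d / c1 * R powr d) * KS_energy M d f R \<le> ennreal ((1 / 2) ^ k)" for k :: nat
    using good_radius[OF W, of "(1 / 2) ^ k"] by simp
  then have "\<exists>R. \<forall>k::nat. R k > 0 \<and> KS_energy M d f (R k) \<le> ennreal (W + (1 / 2) ^ k)
      \<and> ennreal (c2 * 4 powr d / c1 * R k powr d) * KS_energy M d f (R k) \<le> ennreal ((1 / 2) ^ k)"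
    by (intro choice allI)
  then obtain R where R: "\<And>k. 0 < R k" "\<And>k. KS_energy M d f (R k) \<le> ennreal (W + (1 / 2) ^ k)"
      "\<And>k. ennreal (c2 * 4 powr d / c1 * R k powr d) * KS_energy M d f (R k) \<le> ennreal ((1 / 2) ^ k)"
    by blast
  have "\<exists>g. g \<in> borel_measurable M \<and> (\<forall>x. ennreal \<bar>avg M f (ball x (R k / 4)) - f x\<bar> \<le> g x)
      \<and> (\<integral>\<^sup>+x. g x \<partial>M) \<le> ennreal ((1 / 2) ^ k)" for k
  proof (rule avg_defect_le[OF f R(1)[of k]])
    fix g
    assume "g \<in> borel_measurable M" "\<And>x. ennreal \<bar>avg M f (ball x (R k / 4)) - f x\<bar> \<le> g x"
      "(\<integral>\<^sup>+x. g x \<partial>M) \<le> ennreal (c2 * 4 powr d / c1 * R k powr d) * KS_energy M d f (R k)"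
    with R(3)[of k] show ?thesis by (intro exI[of _ g] conjI allI) (assumption | rule order_trans)+
  qed
  then have "\<exists>g. \<forall>k. g k \<in> borel_measurable M \<and> (\<forall>x. ennreal \<bar>avg M f (ball x (R k / 4)) - f x\<bar> \<le> g k x)
      \<and> (\<integral>\<^sup>+x. g k x \<partial>M) \<le> ennreal ((1 / 2) ^ k)"
    by (intro choice allI)
  then obtain g where g [measurable]: "\<And>k. g k \<in> borel_measurable M"
      and g_bound: "\<And>k x. ennreal \<bar>avg M f (ball x (R k / 4)) - f x\<bar> \<le> g k x"
      and g_int: "\<And>k. (\<integral>\<^sup>+x. g k x \<partial>M) \<le> ennreal ((1 / 2) ^ k)"
    by blast
  have "(\<integral>\<^sup>+x. (\<Sum>k. g k x) \<partial>M) = (\<Sum>k. \<integral>\<^sup>+x. g k x \<partial>M)"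
    by (rule nn_integral_suminf) measurable
  also have "\<dots> \<le> (\<Sum>k. ennreal ((1 / 2) ^ k))"
    by (intro suminf_le g_int) auto
  also have "\<dots> = ennreal (\<Sum>k. (1 / 2) ^ k)"
    by (intro suminf_ennreal2) auto
  finally have "(\<integral>\<^sup>+x. (\<Sum>k. g k x) \<partial>M) \<noteq> \<infinity>"
    by (auto simp: top_unique)
  then have AE: "AE x in M. (\<Sum>k. g k x) \<noteq> \<infinity>"
    by (intro nn_integral_PInf_AE) measurable
  define G where "G = {x. (\<Sum>k. g k x) \<noteq> \<infinity>}"
  have "\<bar>f x - f y\<bar> \<le> osc_const * W" if "x \<in> G" "y \<in> G" for x y
  proof -
    have lim: "(\<lambda>k. g k x) \<longlonglongrightarrow> 0" "(\<lambda>k. g k y) \<longlonglongrightarrow> 0"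
      using that by (auto simp: G_def intro!: ennreal_summable_tendsto_0)
    have step: "ennreal \<bar>f x - f y\<bar> \<le> g k x + ennreal (osc_const * (W + (1 / 2) ^ k)) + g k y" for k
    proof -
      define m where "m z = avg M f (ball z (R k / 4))" for z
      \<comment> \<open>The outer terms are defects, which vanish in the limit; the middle one is
        controlled by the energy at scale \<open>R k\<close>.\<close>
      have "\<bar>f x - f y\<bar> \<le> \<bar>m x - f x\<bar> + \<bar>m y - m x\<bar> + \<bar>m y - f y\<bar>" by linarith
      then have "ennreal \<bar>f x - f y\<bar> \<le> ennreal \<bar>m x - f x\<bar> + ennreal \<bar>m y - m x\<bar> + ennreal \<bar>m y - f y\<bar>"
        by (simp add: ennreal_plus[symmetric] ennreal_leI del: ennreal_plus)
      also have "\<dots> \<le> g k x + ennreal osc_const * KS_energy M d f (R k) + g k y"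
        unfolding m_def using R(1)[of k]
        by (intro add_mono g_bound avg_osc_le f chain) auto
      also have "\<dots> \<le> g k x + ennreal (osc_const * (W + (1 / 2) ^ k)) + g k y"
      proof (intro add_mono order_refl)
        have "ennreal osc_const * KS_energy M d f (R k) \<le> ennreal osc_const * ennreal (W + (1 / 2) ^ k)"
          by (intro mult_left_mono R(2)) simp
        also have "\<dots> = ennreal (osc_const * (W + (1 / 2) ^ k))"
          using osc_const_pos W(2) by (intro ennreal_mult[symmetric]) auto
        finally show "ennreal osc_const * KS_energy M d f (R k) \<le> ennreal (osc_const * (W + (1 / 2) ^ k))" .
      qed
      finally show ?thesis .
    qed
    have "(\<lambda>k. osc_const * (W + (1 / 2 :: real) ^ k)) \<longlonglongrightarrow> osc_const * (W + 0)"
      by (intro tendsto_intros LIMSEQ_power_zero) auto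
    then have "(\<lambda>k. g k x + ennreal (osc_const * (W + (1 / 2) ^ k)) + g k y)
        \<longlonglongrightarrow> 0 + ennreal (osc_const * (W + 0)) + 0"
      by (intro tendsto_add lim tendsto_ennrealI)
    then have "ennreal \<bar>f x - f y\<bar> \<le> 0 + ennreal (osc_const * (W + 0)) + 0"
      by (rule LIMSEQ_le_const) (use step in auto)
    then show ?thesis using osc_const_pos W(2) by (simp add: ennreal_le_iff)
  qed
  then show ?thesis using AE by (intro exI[of _ G]) (auto simp: G_def)
qed

text \<open>Comparison with one point \<open>x0\<close> of \<open>G\<close> bounds \<open>f\<close>
  almost everywhere. For the oscillation, Fubini transfers the bound on pairs from \<open>G\<close>
  to almost every pair.\<close>

lemma KS_Linf_Osc_le:
  assumes chain: "\<And>r x y. 0 < r \<Longrightarrow> (x, y) \<in> {(a, b :: 'a). dist a b < r}\<^sup>*"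
    and f: "f \<in> KS M d"
  shows "f \<in> Linf M" "Osc M f \<le> ennreal osc_const * Liminf (at_right 0) (KS_energy M d f)"
proof -
  have fi: "integrable M f" and fin: "Limsup (at_right 0) (KS_energy M d f) < \<infinity>"
    using f by (auto simp: KS_def)
  have [measurable]: "f \<in> borel_measurable M" using fi by simp
  have "Liminf (at_right 0) (KS_energy M d f) \<le> Limsup (at_right 0) (KS_energy M d f)"
    by (intro Liminf_le_Limsup) simp
  then have "Liminf (at_right 0) (KS_energy M d f) < top" using fin by (auto intro: le_less_trans)
  then obtain W where W: "Liminf (at_right 0) (KS_energy M d f) = ennreal W" "0 \<le> W"
    by (cases "Liminf (at_right 0) (KS_energy M d f)") auto
  obtain G where G: "AE x in M. x \<in> G" "\<And>x y. x \<in> G \<Longrightarrow> y \<in> G \<Longrightarrow> \<bar>f x - f y\<bar> \<le> osc_const * W"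
    using AE_diff_le[OF chain fi W] by blast
  \<comment> \<open>A set of full measure is nonempty because balls have positive measure.\<close>
  have "G \<noteq> {}"
  proof
    assume "G = {}"
    then have "AE x in M. False" using G(1) by simp
    then have "emeasure M UNIV = 0" by (simp add: AE_iff_null null_sets_def sets_M)
    moreover have "emeasure M (ball undefined 1) \<le> emeasure M UNIV" by (intro emeasure_mono) (auto simp: sets_M)
    ultimately show False using ball_lower[of 1 undefined] c1_pos by simp
  qed
  then obtain x0 where x0: "x0 \<in> G" by blast
  have "AE x in M. ennreal \<bar>f x\<bar> \<le> ennreal (\<bar>f x0\<bar> + osc_const * W)"
    using G(1)
  proof eventually_elim
    case (elim x)
    show ?case using G(2)[OF elim x0] by (intro ennreal_leI) linarith
  qed
  then have "Linf_norm M f \<le> ennreal (\<bar>f x0\<bar> + osc_const * W)"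
    unfolding Linf_norm_def by (intro esssup_I) auto
  then show "f \<in> Linf M" by (auto simp: Linf_def intro: le_less_trans)
  have "AE z in M \<Otimes>\<^sub>M M. (\<lambda>(x, y). ennreal \<bar>f x - f y\<bar>) z \<le> ennreal (osc_const * W)"
  proof (rule pair.AE_pair_measure)
    show "{z \<in> space (M \<Otimes>\<^sub>M M). (\<lambda>(x, y). ennreal \<bar>f x - f y\<bar>) z \<le> ennreal (osc_const * W)} \<in> sets (M \<Otimes>\<^sub>M M)"
      by measurable
    show "AE x in M. AE y in M. (\<lambda>(x, y). ennreal \<bar>f x - f y\<bar>) (x, y) \<le> ennreal (osc_const * W)"
      using G(1)
    proof eventually_elim
      case (elim x)
      show ?case using G(1) by eventually_elim (use G(2)[OF elim] in \<open>auto intro: ennreal_leI\<close>)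
    qed
  qed
  then have "Osc M f \<le> ennreal (osc_const * W)"
    unfolding Osc_def by (intro esssup_I) auto
  then show "Osc M f \<le> ennreal osc_const * Liminf (at_right 0) (KS_energy M d f)"
    using osc_const_pos W by (simp add: ennreal_mult)
qed

end

section \<open>Off-diagonal decay of the heat semigroup\<close>

text \<open>The function \<open>z powr m * exp (- c * z)\<close> is largest at
  \<open>z = m / c\<close>. The inequality \<open>ln s \<le> s - 1\<close> at
  \<open>s = c * z / m\<close> gives exactly this maximum, \<open>exp (m * l - m)\<close>, as the
  constant.\<close>

lemma exp_le_powr:
  fixes c m :: real
  assumes "0 < c" "0 < m"
  obtains K where "0 < K" "\<And>z. 0 < z \<Longrightarrow> exp (- c * z) \<le> K * z powr (- m)"
proof -
  define l where "l = ln m - ln c"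
  have "exp (- c * z) \<le> exp (m * l - m) * z powr (- m)" if z: "0 < z" for z
  proof -
  have "ln (c * z / m) \<le> c * z / m - 1"
    using assms z by (intro ln_le_minus_one) simp
  also have "ln (c * z / m) = ln z - l"
    using assms z by (simp add: ln_div ln_mult_pos l_def)
  finally have "m * (ln z - l) \<le> m * (c * z / m - 1)"
    using assms(2) by (intro mult_left_mono) auto
  also have "m * (c * z / m - 1) = c * z - m"
    using assms(2) by (simp add: right_diff_distrib)
  finally have "- c * z \<le> (m * l - m) + - m * ln z"
    by (simp add: right_diff_distrib)
  then have "exp (- c * z) \<le> exp ((m * l - m) + - m * ln z)"
    by (simp only: exp_le_cancel_iff)
  also have "\<dots> = exp (m * l - m) * z powr (- m)"
    using z by (simp only: powr_def exp_add) simp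
  finally show ?thesis .
  qed
  then show thesis by (intro that[of "exp (m * l - m)"]) simp_all
qed

text \<open>The decay exponent \<open>m = k * (dW - 1)\<close> undoes the power
  \<open>1 / (dW - 1)\<close> inside the exponential, which leaves
  \<open>(t / r powr dW) powr k\<close> for any chosen \<open>k > 0\<close>.\<close>

lemma sub_gaussian_profile_le:
  assumes dW: "1 < dW" and c: "0 < c" and k: "0 < k"
  obtains K where "0 < K"
    "\<And>t r. 0 < t \<Longrightarrow> 0 < r \<Longrightarrow>
       sub_gaussian_profile dH dW c t r \<le> K * t powr (k - dH / dW) * r powr (- (k * dW))"
proof -
  have m: "0 < k * (dW - 1)" using dW k by simp
  obtain K where K: "0 < K" "\<And>z. 0 < z \<Longrightarrow> exp (- c * z) \<le> K * z powr (- (k * (dW - 1)))"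
    using exp_le_powr[OF c m] by blast
  have "sub_gaussian_profile dH dW c t r \<le> K * t powr (k - dH / dW) * r powr (- (k * dW))"
    if t: "0 < t" and r: "0 < r" for t r
  proof -
    define z where "z = (r powr dW / t) powr (1 / (dW - 1))"
    have z: "0 < z" using t r by (simp add: z_def)
    have "1 / (dW - 1) * - (k * (dW - 1)) = - k" using dW by simp
    then have "z powr (- (k * (dW - 1))) = (r powr dW / t) powr (- k)"
      by (simp only: z_def powr_powr)
    also have "\<dots> = r powr (- (k * dW)) * t powr k"
      using t r powr_divide[of "r powr dW" t "- k"]
      by (simp only: powr_powr powr_minus_divide[of t k]) (simp add: mult.commute)
    finally have zk: "z powr (- (k * (dW - 1))) = r powr (- (k * dW)) * t powr k" .
    have "sub_gaussian_profile dH dW c t r = t powr (- dH / dW) * exp (- c * z)"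
      by (simp add: sub_gaussian_profile_def z_def)
    also have "\<dots> \<le> t powr (- dH / dW) * (K * z powr (- (k * (dW - 1))))"
      by (intro mult_left_mono K(2) z) simp
    also have "\<dots> = K * (t powr (- dH / dW) * t powr k) * r powr (- (k * dW))"
      unfolding zk by (simp only: mult_ac)
    also have "t powr (- dH / dW) * t powr k = t powr (k - dH / dW)"
      by (simp add: powr_add[symmetric])
    finally show ?thesis .
  qed
  with K(1) show thesis by (rule that)
qed

text \<open>Dyadic annuli of radii \<open>a j = 2 ^ j * e\<close>: on the one between
  \<open>a j\<close> and \<open>a (Suc j)\<close> the integrand is at most
  \<open>a j powr (- b)\<close> and the volume at most \<open>c2 * a (Suc j) powr d\<close>. These
  products form a geometric series with ratio \<open>2 powr (d - b) < 1\<close>, uniformly in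
  \<open>x\<close>.\<close>

lemma (in ahlfors_space) tail_integral_bounded:
  assumes b: "d < b" and e: "0 < e"
  obtains S where "0 \<le> S"
    "\<And>x. (\<integral>\<^sup>+y\<in>{y. e \<le> dist x y}. ennreal (dist x y powr (- b)) \<partial>M) \<le> ennreal S"
proof
  define a where "a j = 2 ^ j * e" for j :: nat
  have a: "0 < a j" for j using e by (simp add: a_def)
  define C where "C = e powr (- b) * c2 * (2 * e) powr d"
  define q where "q = (2::real) powr (d - b)"
  have q: "0 < q" "q < 1" using b powr_less_mono[of "d - b" 0 2] by (auto simp: q_def)
  have C: "0 \<le> C" using c2_pos by (simp add: C_def)
  have summ: "summable (\<lambda>j. C * q ^ j)"
    using q by (intro summable_mult summable_geometric) simp
  show "0 \<le> (\<Sum>j. C * q ^ j)" using C q by (intro suminf_nonneg summ) simp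
  fix x :: 'a
  have pw: "ennreal (dist x y powr (- b)) * indicator {y. e \<le> dist x y} y
      \<le> (\<Sum>j. ennreal (a j powr (- b)) * indicator (ball x (a (Suc j))) y)" for y
  proof (cases "e \<le> dist x y")
    case True
    obtain n0 where "dist x y / e < 2 ^ n0" using real_arch_pow[of 2 "dist x y / e"] by auto
    then have ex: "dist x y < a n0" using e by (simp add: a_def field_simps)
    define n where "n = (LEAST n. dist x y < a n)"
    have n: "dist x y < a n" unfolding n_def by (rule LeastI[of _ n0]) (rule ex)
    \<comment> \<open>\<open>a 0 = e\<close> does not exceed the distance, so the least
      \<open>n\<close> has a predecessor, the index of the annulus containing
      \<open>y\<close>.\<close>
    have "n \<noteq> 0" using n True by (cases n) (simp_all add: a_def)
    then obtain j where j: "n = Suc j" by (cases n) auto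
    have "\<not> dist x y < a j" using not_less_Least[of j "\<lambda>n. dist x y < a n"] j by (simp add: n_def)
    then have "dist x y powr (- b) \<le> a j powr (- b)"
      using a[of j] b d_pos by (intro powr_mono2') auto
    then have "ennreal (dist x y powr (- b)) * indicator {y. e \<le> dist x y} y
        \<le> ennreal (a j powr (- b)) * indicator (ball x (a (Suc j))) y"
      using n True j by (simp add: ennreal_leI)
    also have "\<dots> \<le> (\<Sum>i. ennreal (a i powr (- b)) * indicator (ball x (a (Suc i))) y)"
    proof -
      have "F j \<le> suminf F" for F :: "nat \<Rightarrow> ennreal"
        using sum_le_suminf[of F "{j}"] by simp
      then show ?thesis by this
    qed
    finally show ?thesis .
  qed simp
  have "(\<integral>\<^sup>+y\<in>{y. e \<le> dist x y}. ennreal (dist x y powr (- b)) \<partial>M)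
      \<le> (\<integral>\<^sup>+y. (\<Sum>j. ennreal (a j powr (- b)) * indicator (ball x (a (Suc j))) y) \<partial>M)"
    by (intro nn_integral_mono pw)
  also have "\<dots> = (\<Sum>j. \<integral>\<^sup>+y. ennreal (a j powr (- b)) * indicator (ball x (a (Suc j))) y \<partial>M)"
    by (rule nn_integral_suminf) measurable
  also have "\<dots> = (\<Sum>j. ennreal (a j powr (- b)) * emeasure M (ball x (a (Suc j))))"
    by (simp add: nn_integral_cmult_indicator)
  also have "\<dots> \<le> (\<Sum>j. ennreal (C * q ^ j))"
  proof (intro suminf_le)
    fix j
    have "ennreal (a j powr (- b)) * emeasure M (ball x (a (Suc j)))
        \<le> ennreal (a j powr (- b)) * ennreal (c2 * a (Suc j) powr d)"
      using a[of "Suc j"] by (intro mult_left_mono ball_upper) auto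
    also have "\<dots> = ennreal (a j powr (- b) * (c2 * a (Suc j) powr d))"
      using c2_pos by (intro ennreal_mult[symmetric]) auto
    also have "a j powr (- b) * (c2 * a (Suc j) powr d) = C * q ^ j"
    proof -
      have "(2 ^ j :: real) = 2 powr real j" by (simp add: powr_realpow)
      then have aj: "a j = 2 powr real j * e" "a (Suc j) = 2 powr real j * (2 * e)" by (auto simp: a_def)
      have "q ^ j = q powr real j" using q by (simp add: powr_realpow)
      also have "\<dots> = (2 powr real j) powr d * (2 powr real j) powr (- b)"
        by (simp add: q_def powr_powr powr_add[symmetric] algebra_simps)
      finally have qj: "q ^ j = (2 powr real j) powr d * (2 powr real j) powr (- b)" .
      show ?thesis
        unfolding aj C_def qj using e by (simp add: powr_mult)
    qed
    finally show "ennreal (a j powr (- b)) * emeasure M (ball x (a (Suc j))) \<le> ennreal (C * q ^ j)" .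
  qed auto
  also have "\<dots> = ennreal (\<Sum>j. C * q ^ j)"
    using C q by (intro suminf_ennreal2 summ) simp
  finally show "(\<integral>\<^sup>+y\<in>{y. e \<le> dist x y}. ennreal (dist x y powr (- b)) \<partial>M) \<le> ennreal (\<Sum>j. C * q ^ j)" .
qed

lemma L2_indicator:
  assumes "w \<in> L2 M" "S \<in> sets M"
  shows "(\<lambda>x. indicator S x * w x) \<in> L2 M"
proof -
  have "integrable M (\<lambda>x. indicat_real S x *\<^sub>R (w x)\<^sup>2)"
    using assms by (intro integrable_mult_indicator) (auto simp: L2_def)
  moreover have "(\<lambda>x. indicat_real S x *\<^sub>R (w x)\<^sup>2) = (\<lambda>x. (indicator S x * w x)\<^sup>2)"
    by (auto simp: indicator_def)
  ultimately show ?thesis using assms by (auto simp: L2_def)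
qed

lemma L2_normsq_indicator_le:
  assumes "w \<in> L2 M" "S \<in> sets M"
  shows "L2_normsq M (\<lambda>x. indicator S x * w x) \<le> L2_normsq M w"
  unfolding L2_normsq_def
  using assms L2_indicator[OF assms]
  by (intro integral_mono) (auto simp: L2_def indicator_def)

lemma nn_integral_square_L2:
  assumes "w \<in> L2 M"
  shows "(\<integral>\<^sup>+x. ennreal ((w x)\<^sup>2) \<partial>M) = ennreal (L2_normsq M w)"
  unfolding L2_normsq_def using assms by (intro nn_integral_eq_integral) (auto simp: L2_def)

text \<open>For a nonintegrable \<open>f\<close> the Bochner integral is 0 by convention, so the
  bound covers that case too.\<close>

lemma ennreal_abs_integral_le: "ennreal \<bar>\<integral>x. f x \<partial>M\<bar> \<le> (\<integral>\<^sup>+x. ennreal \<bar>f x\<bar> \<partial>M)"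
  using integral_norm_bound_ennreal[of M f] by (cases "integrable M f") (auto simp: not_integrable_integral_eq)

text \<open>The kernel bounds are in iterated form, for almost every \<open>x\<close> and then
  almost every \<open>y\<close>, because \<open>kernel_op\<close> integrates over \<open>y\<close>
  at a fixed \<open>x\<close>.\<close>

locale sub_gaussian_semigroup = ahlfors_space M d c1 c2
  for M :: "'a::metric_space measure" and d c1 c2 +
  fixes P :: "real \<Rightarrow> ('a \<Rightarrow> real) \<Rightarrow> 'a \<Rightarrow> real"
    and p :: "real \<Rightarrow> 'a \<Rightarrow> 'a \<Rightarrow> real"
    and dW c3 c4 c5 c6 :: real
  assumes semigroup: "L2_semigroup M P"
    and P_eq: "\<And>t g. 0 < t \<Longrightarrow> g \<in> L2 M \<Longrightarrow> AE x in M. P t g x = kernel_op M p t g x"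
    and p_measurable: "\<And>t x. 0 < t \<Longrightarrow> p t x \<in> borel_measurable M"
    and dW: "1 < dW"
    and c_pos: "0 < c3" "0 < c4" "0 < c5" "0 < c6"
    and p_bounds: "\<And>t. 0 < t \<Longrightarrow> AE x in M. AE y in M.
        c5 * sub_gaussian_profile d dW c6 t (dist x y) \<le> p t x y \<and>
        p t x y \<le> c3 * sub_gaussian_profile d dW c4 t (dist x y)"
begin

lemma P_L2: "0 < t \<Longrightarrow> f \<in> L2 M \<Longrightarrow> P t f \<in> L2 M"
  using semigroup by (simp add: L2_semigroup_def)

lemma P_contraction: "0 < t \<Longrightarrow> f \<in> L2 M \<Longrightarrow> L2_normsq M (P t f) \<le> L2_normsq M f"
  using semigroup by (simp add: L2_semigroup_def)

lemma P_add: "0 < t \<Longrightarrow> f \<in> L2 M \<Longrightarrow> g \<in> L2 M \<Longrightarrow> AE x in M. P t (\<lambda>y. f y + g y) x = P t f x + P t g x"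
proof -
  assume a: "0 < t" "f \<in> L2 M" "g \<in> L2 M"
  have "\<forall>t>0. \<forall>f\<in>L2 M. \<forall>g\<in>L2 M. \<forall>a b.
      AE x in M. P t (\<lambda>y. a * f y + b * g y) x = a * P t f x + b * P t g x"
    using semigroup unfolding L2_semigroup_def by (elim conjE)
  from this[rule_format, OF a, of 1 1] show ?thesis by simp
qed

lemma P_comp: "0 < s \<Longrightarrow> 0 < t \<Longrightarrow> f \<in> L2 M \<Longrightarrow> AE x in M. P (s + t) f x = P s (P t f) x"
proof -
  assume a: "0 < s" "0 < t" "f \<in> L2 M"
  have "\<forall>s>0. \<forall>t>0. \<forall>f\<in>L2 M. AE x in M. P (s + t) f x = P s (P t f) x"
    using semigroup unfolding L2_semigroup_def by (elim conjE)
  from this[rule_format, OF a] show ?thesis .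
qed

text \<open>Off-diagonal decay: the part of the kernel with \<open>dist x y \<ge> e\<close> has both marginals of order
  \<open>t\<^sup>3\<close>, and the Schur test is replaced by \<open>\<bar>w y\<bar> * \<bar>h x\<bar> \<le> (w y)\<^sup>2 + (h x)\<^sup>2\<close>.\<close>

lemma off_diagonal:
  assumes e: "0 < e" and A: "A \<in> sets M" and sep: "\<And>x y. x \<in> A \<Longrightarrow> y \<notin> A \<Longrightarrow> e \<le> dist x y"
  obtains D where "0 \<le> D"
    "\<And>t w. 0 < t \<Longrightarrow> w \<in> L2 M \<Longrightarrow> (\<And>x. x \<notin> A \<Longrightarrow> w x = 0) \<Longrightarrow>
       L2_normsq M (\<lambda>x. indicator (- A) x * P t w x) \<le> D * t ^ 3 * L2_normsq M w"
proof -
  \<comment> \<open>The power of \<open>t\<close> in the profile bound becomes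
    \<open>k - d / dW = 3\<close>, and \<open>k * dW = d + 3 * dW\<close> exceeds \<open>d\<close>,
    as the tail integral requires.\<close>
  define k where "k = d / dW + 3"
  have k: "0 < k" using d_pos dW by (simp add: k_def add_pos_pos)
  have kd: "d < k * dW" using dW by (simp add: k_def distrib_right)
  obtain K where K: "0 < K" "\<And>t r. 0 < t \<Longrightarrow> 0 < r \<Longrightarrow>
       sub_gaussian_profile d dW c4 t r \<le> K * t powr (k - d / dW) * r powr (- (k * dW))"
    using sub_gaussian_profile_le[OF dW c_pos(2) k] by blast
  obtain S where S: "0 \<le> S"
    "\<And>x. (\<integral>\<^sup>+y\<in>{y. e \<le> dist x y}. ennreal (dist x y powr (- (k * dW))) \<partial>M) \<le> ennreal S"
    using tail_integral_bounded[OF kd e] by blast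
  have mA [measurable]: "- A \<in> sets M" using A sets.compl_sets[OF A] by (simp add: Compl_eq_Diff_UNIV)
  show thesis
  proof (rule that[of "2 * (c3 * K * S)"])
    show "0 \<le> 2 * (c3 * K * S)" using c_pos K(1) S(1) by simp
    fix t w assume t: "(0::real) < t" and w: "w \<in> L2 M" and w0: "\<And>x. x \<notin> A \<Longrightarrow> w x = 0"
    have [measurable]: "w \<in> borel_measurable M" using w by (simp add: L2_def)
    define L where "L = c3 * K * t ^ 3"
    have L: "0 \<le> L" using c_pos K(1) t by (simp add: L_def)
    \<comment> \<open>A symmetric majorant of the kernel on pairs at distance at least
      \<open>e\<close>; by symmetry one bound serves for both marginals.\<close>
    define g :: "'a \<Rightarrow> 'a \<Rightarrow> ennreal" where "g x y = ennreal L * (ennreal (dist x y powr (- (k * dW))) * indicator {y. e \<le> dist x y} y)" for x y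
    have [measurable]: "(\<lambda>(x, y). g x y) \<in> borel_measurable (M \<Otimes>\<^sub>M M)"
      unfolding g_def by measurable
    have g_int: "(\<integral>\<^sup>+y. g x y \<partial>M) \<le> ennreal (L * S)" for x
    proof -
      have "(\<integral>\<^sup>+y. g x y \<partial>M) = ennreal L * (\<integral>\<^sup>+y\<in>{y. e \<le> dist x y}. ennreal (dist x y powr (- (k * dW))) \<partial>M)"
        unfolding g_def by (rule nn_integral_cmult) measurable
      also have "\<dots> \<le> ennreal L * ennreal S" by (intro mult_left_mono S(2)) simp
      also have "\<dots> = ennreal (L * S)" using L S(1) by (rule ennreal_mult[symmetric])
      finally show ?thesis .
    qed
    have g_sym: "g x y = g y x" for x y by (simp add: g_def dist_commute indicator_def)
    define h where "h x = indicator (- A) x * P t w x" for x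
    have hL2: "h \<in> L2 M" unfolding h_def by (intro L2_indicator P_L2 t w mA)
    then have [measurable]: "h \<in> borel_measurable M" by (simp add: L2_def)
    have hw: "L2_normsq M h \<le> L2_normsq M w"
      unfolding h_def using L2_normsq_indicator_le[OF P_L2[OF t w] mA] P_contraction[OF t w] by linarith
    have h_le: "AE x in M. ennreal \<bar>h x\<bar> \<le> (\<integral>\<^sup>+y. g x y * ennreal \<bar>w y\<bar> \<partial>M)"
      using P_eq[OF t w] p_bounds[OF t]
    proof eventually_elim
      case (elim x)
      show ?case
      proof (cases "x \<in> A")
        case False
        have "ennreal \<bar>h x\<bar> \<le> (\<integral>\<^sup>+y. ennreal \<bar>p t x y * w y\<bar> \<partial>M)"
          using elim(1) False ennreal_abs_integral_le by (simp add: h_def kernel_op_def)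
        also have "\<dots> \<le> (\<integral>\<^sup>+y. g x y * ennreal \<bar>w y\<bar> \<partial>M)"
        proof (rule nn_integral_mono_AE)
          show "AE y in M. ennreal \<bar>p t x y * w y\<bar> \<le> g x y * ennreal \<bar>w y\<bar>"
            using elim(2)
          proof eventually_elim
            case (elim y)
            show ?case
            proof (cases "y \<in> A")
              case True
              then have ed: "e \<le> dist x y" using sep[OF True False] by (simp add: dist_commute)
              have "0 \<le> sub_gaussian_profile d dW c6 t (dist x y)" by (simp add: sub_gaussian_profile_def)
              \<comment> \<open>The lower kernel bound provides the sign, so that the upper bound
                controls the absolute value.\<close>
              then have p0: "0 \<le> p t x y" using elim c_pos(3) by (meson mult_nonneg_nonneg less_imp_le order_trans)
              have "p t x y \<le> c3 * sub_gaussian_profile d dW c4 t (dist x y)" using elim by simp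
              also have "\<dots> \<le> c3 * (K * t powr (k - d / dW) * dist x y powr (- (k * dW)))"
                using c_pos(1) e ed by (intro mult_left_mono K(2) t) linarith+
              also have "\<dots> = L * dist x y powr (- (k * dW))"
                using t by (simp add: L_def k_def powr_numeral)
              finally have "p t x y \<le> L * dist x y powr (- (k * dW))" .
              then have "ennreal \<bar>p t x y\<bar> \<le> g x y"
                unfolding g_def using ed p0 L by (simp add: ennreal_mult[symmetric] ennreal_leI)
              then have "ennreal \<bar>p t x y\<bar> * ennreal \<bar>w y\<bar> \<le> g x y * ennreal \<bar>w y\<bar>"
                by (rule mult_right_mono) simp
              then show ?thesis by (simp add: abs_mult ennreal_mult)
            qed (simp add: w0)
          qed
        qed
        finally show ?thesis .
      qed (simp add: h_def)
    qed
    have "ennreal (L2_normsq M h) = (\<integral>\<^sup>+x. ennreal \<bar>h x\<bar> * ennreal \<bar>h x\<bar> \<partial>M)"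
      unfolding nn_integral_square_L2[OF hL2, symmetric]
      by (simp add: ennreal_mult[symmetric] power2_eq_square)
    also have "\<dots> \<le> (\<integral>\<^sup>+x. ennreal \<bar>h x\<bar> * (\<integral>\<^sup>+y. g x y * ennreal \<bar>w y\<bar> \<partial>M) \<partial>M)"
      using h_le by (intro nn_integral_mono_AE) (auto elim!: eventually_mono intro!: mult_left_mono)
    also have "\<dots> = (\<integral>\<^sup>+x. (\<integral>\<^sup>+y. ennreal \<bar>h x\<bar> * (g x y * ennreal \<bar>w y\<bar>) \<partial>M) \<partial>M)"
      by (intro nn_integral_cong nn_integral_cmult[symmetric]) measurable
    also have "\<dots> \<le> (\<integral>\<^sup>+x. (\<integral>\<^sup>+y. g x y * ennreal ((w y)\<^sup>2) + g x y * ennreal ((h x)\<^sup>2) \<partial>M) \<partial>M)"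
    proof (intro nn_integral_mono)
      fix x y
      have "\<bar>h x\<bar> * \<bar>w y\<bar> \<le> (w y)\<^sup>2 + (h x)\<^sup>2"
      proof -
        have "2 * \<bar>h x\<bar> * \<bar>w y\<bar> \<le> (h x)\<^sup>2 + (w y)\<^sup>2"
          using sum_squares_bound[of "\<bar>h x\<bar>" "\<bar>w y\<bar>"] by simp
        moreover have "0 \<le> \<bar>h x\<bar> * \<bar>w y\<bar>" by simp
        ultimately show ?thesis by linarith
      qed
      then have "ennreal \<bar>h x\<bar> * ennreal \<bar>w y\<bar> \<le> ennreal ((w y)\<^sup>2) + ennreal ((h x)\<^sup>2)"
        by (simp add: ennreal_mult[symmetric] ennreal_plus[symmetric] ennreal_leI del: ennreal_plus)
      then have "g x y * (ennreal \<bar>h x\<bar> * ennreal \<bar>w y\<bar>) \<le> g x y * (ennreal ((w y)\<^sup>2) + ennreal ((h x)\<^sup>2))"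
        by (rule mult_left_mono) simp
      then show "ennreal \<bar>h x\<bar> * (g x y * ennreal \<bar>w y\<bar>) \<le> g x y * ennreal ((w y)\<^sup>2) + g x y * ennreal ((h x)\<^sup>2)"
        by (simp add: distrib_left mult_ac)
    qed
    also have "\<dots> = (\<integral>\<^sup>+x. (\<integral>\<^sup>+y. g x y * ennreal ((w y)\<^sup>2) \<partial>M) + (\<integral>\<^sup>+y. g x y * ennreal ((h x)\<^sup>2) \<partial>M) \<partial>M)"
      by (intro nn_integral_cong nn_integral_add) measurable
    also have "\<dots> = (\<integral>\<^sup>+x. (\<integral>\<^sup>+y. g x y * ennreal ((w y)\<^sup>2) \<partial>M) \<partial>M) + (\<integral>\<^sup>+x. (\<integral>\<^sup>+y. g x y * ennreal ((h x)\<^sup>2) \<partial>M) \<partial>M)"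
      by (rule nn_integral_add) measurable
    also have "(\<integral>\<^sup>+x. (\<integral>\<^sup>+y. g x y * ennreal ((w y)\<^sup>2) \<partial>M) \<partial>M) = (\<integral>\<^sup>+y. (\<integral>\<^sup>+x. g y x * ennreal ((w y)\<^sup>2) \<partial>M) \<partial>M)"
    proof -
      have "(\<integral>\<^sup>+x. (\<integral>\<^sup>+y. g x y * ennreal ((w y)\<^sup>2) \<partial>M) \<partial>M) = (\<integral>\<^sup>+y. (\<integral>\<^sup>+x. g x y * ennreal ((w y)\<^sup>2) \<partial>M) \<partial>M)"
        by (rule pair.Fubini'[symmetric]) measurable
      also have "\<dots> = (\<integral>\<^sup>+y. (\<integral>\<^sup>+x. g y x * ennreal ((w y)\<^sup>2) \<partial>M) \<partial>M)"
        by (intro nn_integral_cong arg_cong2[where f="(*)"] g_sym refl)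
      finally show ?thesis .
    qed
    also have "\<dots> \<le> ennreal (L * S) * ennreal (L2_normsq M w)"
    proof -
      have "(\<integral>\<^sup>+y. (\<integral>\<^sup>+x. g y x * ennreal ((w y)\<^sup>2) \<partial>M) \<partial>M) = (\<integral>\<^sup>+y. (\<integral>\<^sup>+x. g y x \<partial>M) * ennreal ((w y)\<^sup>2) \<partial>M)"
        by (intro nn_integral_cong nn_integral_multc) measurable
      also have "\<dots> \<le> (\<integral>\<^sup>+y. ennreal (L * S) * ennreal ((w y)\<^sup>2) \<partial>M)"
        by (intro nn_integral_mono mult_right_mono g_int) simp
      also have "\<dots> = ennreal (L * S) * (\<integral>\<^sup>+y. ennreal ((w y)\<^sup>2) \<partial>M)"
        by (rule nn_integral_cmult) measurable
      finally show ?thesis by (simp add: nn_integral_square_L2[OF w])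
    qed
    also have "(\<integral>\<^sup>+x. (\<integral>\<^sup>+y. g x y * ennreal ((h x)\<^sup>2) \<partial>M) \<partial>M) \<le> ennreal (L * S) * ennreal (L2_normsq M h)"
    proof -
      have "(\<integral>\<^sup>+y. (\<integral>\<^sup>+x. g y x * ennreal ((h y)\<^sup>2) \<partial>M) \<partial>M) = (\<integral>\<^sup>+y. (\<integral>\<^sup>+x. g y x \<partial>M) * ennreal ((h y)\<^sup>2) \<partial>M)"
        by (intro nn_integral_cong nn_integral_multc) measurable
      also have "\<dots> \<le> (\<integral>\<^sup>+y. ennreal (L * S) * ennreal ((h y)\<^sup>2) \<partial>M)"
        by (intro nn_integral_mono mult_right_mono g_int) simp
      also have "\<dots> = ennreal (L * S) * (\<integral>\<^sup>+y. ennreal ((h y)\<^sup>2) \<partial>M)"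
        by (rule nn_integral_cmult) measurable
      finally show ?thesis by (simp add: nn_integral_square_L2[OF hL2])
    qed
    also have "ennreal (L * S) * ennreal (L2_normsq M h) \<le> ennreal (L * S) * ennreal (L2_normsq M w)"
      using hw by (intro mult_left_mono ennreal_leI) auto
    finally have "ennreal (L2_normsq M h) \<le> ennreal (L * S) * ennreal (L2_normsq M w) + ennreal (L * S) * ennreal (L2_normsq M w)"
      by (simp add: add_left_mono)
    also have "\<dots> = ennreal (2 * (L * S) * L2_normsq M w)"
    proof -
      have "0 \<le> L * S * L2_normsq M w" using L S(1) by (simp add: L2_normsq_def)
      then show ?thesis using L S(1)
        by (simp add: ennreal_mult'[symmetric] ennreal_plus[symmetric] del: ennreal_plus)
    qed
    finally have "L2_normsq M h \<le> 2 * (L * S) * L2_normsq M w"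
      using L S(1) by (subst (asm) ennreal_le_iff) (auto simp: L2_normsq_def)
    then show "L2_normsq M (\<lambda>x. indicator (- A) x * P t w x) \<le> 2 * (c3 * K * S) * t ^ 3 * L2_normsq M w"
      by (simp add: h_def[abs_def] L_def mult_ac)
  qed
qed

section \<open>Invariance of separated sets and existence of chains\<close>

text \<open>Time 1 is split into \<open>n\<close> steps of length \<open>t = 1 / n\<close>, and
  \<open>\<phi> k\<close> is the squared norm outside \<open>A\<close> after \<open>k\<close> steps.
  A step multiplies it by at most \<open>1 + t\<close> and adds a leak of order
  \<open>(1 + 1 / t) * t ^ 3\<close>; the total over \<open>n\<close> steps is of order
  \<open>1 / n\<close>.\<close>

lemma invariant_if_separated:
  assumes e: "0 < e" and A: "A \<in> sets M" and sep: "\<And>x y. x \<in> A \<Longrightarrow> y \<notin> A \<Longrightarrow> e \<le> dist x y"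
    and u: "u \<in> L2 M" "\<And>x. x \<notin> A \<Longrightarrow> u x = 0"
  shows "L2_normsq M (\<lambda>x. indicator (- A) x * P 1 u x) = 0"
proof -
  obtain D where D: "0 \<le> D" "\<And>t w. 0 < t \<Longrightarrow> w \<in> L2 M \<Longrightarrow> (\<And>x. x \<notin> A \<Longrightarrow> w x = 0) \<Longrightarrow>
       L2_normsq M (\<lambda>x. indicator (- A) x * P t w x) \<le> D * t ^ 3 * L2_normsq M w"
    using off_diagonal[OF e A sep] by blast
  have B: "- A \<in> sets M" using A sets.compl_sets[OF A] by (simp add: Compl_eq_Diff_UNIV)
  define Nu where "Nu = L2_normsq M u"
  have Nu: "0 \<le> Nu" by (simp add: Nu_def L2_normsq_def)
  have bound: "L2_normsq M (\<lambda>x. indicator (- A) x * P 1 u x)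
      \<le> exp 1 * D * Nu * ((1 + real n) / (real n)\<^sup>2)" if n: "0 < n" for n :: nat
  proof -
    define t where "t = 1 / real n"
    have t: "0 < t" using n by (simp add: t_def)
    \<comment> \<open>The semigroup laws concern positive times only, so time 0 is set to
      \<open>u\<close> separately.\<close>
    define U where "U k = (if k = 0 then u else P (real k * t) u)" for k :: nat
    define \<phi> where "\<phi> k = L2_normsq M (\<lambda>x. indicator (- A) x * U k x)" for k
    define c where "c = (1 + 1 / t) * (D * t ^ 3 * Nu)"
    have c: "0 \<le> c" using t D Nu by (simp add: c_def)
    have UL2: "U k \<in> L2 M" for k using t u(1) by (auto simp: U_def intro!: P_L2)
    have UNu: "L2_normsq M (U k) \<le> Nu" for k
      using t u(1) by (auto simp: U_def Nu_def intro!: P_contraction)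
    have USuc: "AE x in M. U (Suc k) x = P t (U k) x" for k
    proof (cases "k = 0")
      case False
      then have "AE x in M. P (t + real k * t) u x = P t (P (real k * t) u) x"
        using t u(1) by (intro P_comp) auto
      then show ?thesis using False by (simp add: U_def distrib_right)
    qed (simp add: U_def)
    have step: "\<phi> (Suc k) \<le> (1 + t) * \<phi> k + c" for k
    proof -
      \<comment> \<open>\<open>w1\<close> is the part still in \<open>A\<close>, whose leak is
        bounded by off-diagonal decay; \<open>w2\<close> has already left and is bounded by
        contraction.\<close>
      define w1 where "w1 x = indicator A x * U k x" for x
      define w2 where "w2 x = indicator (- A) x * U k x" for x
      have w: "w1 \<in> L2 M" "w2 \<in> L2 M"
        unfolding w1_def w2_def by (intro L2_indicator UL2 A B)+
      have "(\<lambda>y. w1 y + w2 y) = U k" by (auto simp: w1_def w2_def indicator_def)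
      with P_add[OF t w] have add: "AE x in M. P t (U k) x = P t w1 x + P t w2 x" by simp
      define a where "a x = indicator (- A) x * P t w1 x" for x
      define b where "b x = indicator (- A) x * P t w2 x" for x
      have ab: "a \<in> L2 M" "b \<in> L2 M"
        unfolding a_def b_def by (intro L2_indicator P_L2 t w B)+
      have "(\<lambda>x. indicator (- A) x * U (Suc k) x) \<in> L2 M" by (intro L2_indicator UL2 B)
      then have "\<phi> (Suc k) \<le> (\<integral>x. (1 + 1 / t) * (a x)\<^sup>2 + (1 + t) * (b x)\<^sup>2 \<partial>M)"
        unfolding \<phi>_def L2_normsq_def
      proof (intro integral_mono_AE)
        show "AE x in M. (indicator (- A) x * U (Suc k) x)\<^sup>2 \<le> (1 + 1 / t) * (a x)\<^sup>2 + (1 + t) * (b x)\<^sup>2"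
          using USuc[of k] add
        proof eventually_elim
          case (elim x)
          then have "indicator (- A) x * U (Suc k) x = a x + b x"
            by (simp add: a_def b_def distrib_left)
          \<comment> \<open>Young's inequality weighted by \<open>t\<close>: the factor on the
            accumulated part \<open>b\<close> stays at \<open>1 + t\<close>, harmless over
            \<open>n\<close> steps, while the factor \<open>1 / t\<close> falls on the small leak
            \<open>a\<close>.\<close>
          moreover have "0 \<le> (a x - t * b x)\<^sup>2 / t" using t by simp
          then have "(a x + b x)\<^sup>2 \<le> (1 + 1 / t) * (a x)\<^sup>2 + (1 + t) * (b x)\<^sup>2"
            using t by (simp add: power2_eq_square field_simps)
          ultimately show ?case by simp
        qed
      qed (use ab in \<open>auto simp: L2_def\<close>)
      also have "\<dots> = (1 + 1 / t) * L2_normsq M a + (1 + t) * L2_normsq M b"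
        using ab by (simp add: L2_normsq_def L2_def)
      also have "\<dots> \<le> (1 + 1 / t) * (D * t ^ 3 * Nu) + (1 + t) * \<phi> k"
      proof (intro add_mono mult_left_mono)
        have "L2_normsq M a \<le> D * t ^ 3 * L2_normsq M w1"
          unfolding a_def by (intro D(2) t w(1)) (simp add: w1_def)
        also have "L2_normsq M w1 \<le> Nu"
          unfolding w1_def using L2_normsq_indicator_le[OF UL2 A] UNu order_trans by blast
        finally show "L2_normsq M a \<le> D * t ^ 3 * Nu" using D(1) t by (simp add: mult_left_mono)
        have "L2_normsq M b \<le> L2_normsq M (P t w2)"
          unfolding b_def by (intro L2_normsq_indicator_le P_L2 t w B)
        also have "\<dots> \<le> L2_normsq M w2" by (intro P_contraction t w)
        finally show "L2_normsq M b \<le> \<phi> k" by (simp add: \<phi>_def w2_def[abs_def])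
      qed (use t in auto)
      finally show ?thesis by (simp add: c_def)
    qed
    \<comment> \<open>The recursion starts at 0 since \<open>u\<close> vanishes off
      \<open>A\<close>; each of the \<open>k\<close> leaks is charged the full growth factor
      \<open>(1 + t) ^ k\<close>.\<close>
    have "\<phi> k \<le> real k * (1 + t) ^ k * c" for k
    proof (induction k)
      case 0
      have "(\<lambda>x. indicator (- A) x * u x) = (\<lambda>x. 0)" 
      by (rule ext, rename_tac x, case_tac "x \<in> A") (simp_all add: u(2))
      then show ?case by (simp add: \<phi>_def U_def L2_normsq_def)
    next
      case (Suc k)
      have "\<phi> (Suc k) \<le> (1 + t) * (real k * (1 + t) ^ k * c) + c"
        using step[of k] mult_left_mono[OF Suc.IH, of "1 + t"] t by linarith
      also have "\<dots> \<le> (1 + t) * (real k * (1 + t) ^ k * c) + (1 + t) ^ Suc k * c"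
        using mult_right_mono[OF one_le_power[of "1 + t" "Suc k"] c] t by simp
      also have "\<dots> = real (Suc k) * (1 + t) ^ Suc k * c" by (simp add: algebra_simps)
      finally show ?case .
    qed
    from this[of n] have "\<phi> n \<le> real n * (1 + t) ^ n * c" .
    also have "\<dots> \<le> real n * exp 1 * c"
    proof (intro mult_right_mono mult_left_mono c)
      have "(1 + t) ^ n \<le> exp t ^ n" using t by (intro power_mono) auto
      also have "\<dots> = exp 1" using n by (simp add: exp_of_nat_mult[symmetric] t_def)
      finally show "(1 + t) ^ n \<le> exp 1" .
    qed simp
    also have "\<dots> = exp 1 * D * Nu * ((1 + real n) / (real n)\<^sup>2)"
      using n by (simp add: c_def t_def field_simps power2_eq_square power3_eq_cube)
    finally show ?thesis using n by (simp add: \<phi>_def U_def t_def)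
  qed
  have "(\<lambda>n. exp 1 * D * Nu * ((1 + real n) / (real n)\<^sup>2)) \<longlonglongrightarrow> exp 1 * D * Nu * 0"
  proof (intro tendsto_mult tendsto_const)
    have lim: "(\<lambda>n. inverse (real n) * inverse (real n) + inverse (real n)) \<longlonglongrightarrow> 0 * 0 + 0"
      by (intro tendsto_intros lim_inverse_n)
    have "(1 + real n) / (real n)\<^sup>2 = inverse (real n) * inverse (real n) + inverse (real n)" for n
      by (cases "n = 0") (simp_all add: field_simps power2_eq_square)
    then show "(\<lambda>n. (1 + real n) / (real n)\<^sup>2) \<longlonglongrightarrow> 0"
      using lim by simp
  qed
  then have "L2_normsq M (\<lambda>x. indicator (- A) x * P 1 u x) \<le> exp 1 * D * Nu * 0"
    by (rule LIMSEQ_le_const) (use bound in \<open>auto intro!: exI[of _ 1]\<close>)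
  then show ?thesis by (simp add: L2_normsq_def integral_nonneg_AE antisym)
qed

text \<open>The lower kernel bound makes the integrand strictly positive on \<open>A\<close>. The
  upper bound, which is at most \<open>c3\<close> at time 1, gives integrability, so that a
  vanishing integral would force \<open>A\<close> to be null.\<close>

lemma P_indicator_pos:
  assumes A: "A \<in> sets M" and fin: "emeasure M A < \<infinity>" and pos: "0 < emeasure M A"
  shows "AE x in M. 0 < P 1 (indicator A) x"
proof -
  have iA: "integrable M (indicat_real A)" using A fin by (simp add: integrable_indicator_iff)
  have "(\<lambda>x. (indicat_real A x)\<^sup>2) = indicat_real A" by (auto simp: indicator_def)
  then have L2: "indicator A \<in> L2 M" using iA by (simp add: L2_def)
  show ?thesis
    using P_eq[OF zero_less_one L2] p_bounds[OF zero_less_one]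
  proof eventually_elim
    case (elim x)
    have [measurable]: "p 1 x \<in> borel_measurable M" by (rule p_measurable) simp
    have lower: "AE y in M. 0 < p 1 x y"
      using elim(2)
    proof eventually_elim
      case (elim y)
      have "0 < c5 * sub_gaussian_profile d dW c6 1 (dist x y)"
        using c_pos by (simp add: sub_gaussian_profile_def)
      then show "0 < p 1 x y" using elim by linarith
    qed
    have upper: "AE y in M. p 1 x y \<le> c3"
      using elim(2)
    proof eventually_elim
      case (elim y)
      have "sub_gaussian_profile d dW c4 1 (dist x y) \<le> 1"
        using c_pos by (simp add: sub_gaussian_profile_def)
      then have "c3 * sub_gaussian_profile d dW c4 1 (dist x y) \<le> c3"
        using c_pos by simp
      then show "p 1 x y \<le> c3" using elim by linarith
    qed
    have int: "integrable M (\<lambda>y. p 1 x y * indicator A y)"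
    proof (rule Bochner_Integration.integrable_bound)
      show "integrable M (\<lambda>y. c3 * indicat_real A y)" using iA by simp
      show "AE y in M. norm (p 1 x y * indicator A y) \<le> norm (c3 * indicat_real A y)"
        using lower upper by eventually_elim (auto simp: indicator_def)
    qed (use A in measurable)
    have nn: "AE y in M. 0 \<le> p 1 x y * indicator A y"
      using lower by eventually_elim (simp add: indicator_def)
    have "(\<integral>y. p 1 x y * indicator A y \<partial>M) \<noteq> 0"
    proof
      assume "(\<integral>y. p 1 x y * indicator A y \<partial>M) = 0"
      then have "AE y in M. p 1 x y * indicator A y = 0"
        using integral_nonneg_eq_0_iff_AE[OF int nn] by simp
      with lower have "AE y in M. y \<notin> A"
        by eventually_elim (auto simp: indicator_def split: if_splits)
      then have "emeasure M A = 0" using A by (simp add: AE_iff_null_sets null_setsD1)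
      with pos show False by simp
    qed
    then show ?case
      using elim(1) integral_nonneg_AE[OF nn] by (simp add: kernel_op_def)
  qed
qed

text \<open>The set \<open>A\<close> of points reachable from \<open>x\<close> is at distance at
  least \<open>r\<close> from its complement. If \<open>y\<close> were outside, \<open>P 1\<close>
  of an indicator inside \<open>A\<close> would vanish almost everywhere on \<open>- A\<close>, yet
  it is positive almost everywhere, and \<open>- A\<close> contains a ball around
  \<open>y\<close>.\<close>

lemma chain_connected:
  assumes r: "0 < r"
  shows "(x, y) \<in> {(a, b :: 'a). dist a b < r}\<^sup>*"
proof (rule ccontr)
  define R where "R = {(a, b :: 'a). dist a b < r}"
  define A where "A = {z. (x, z) \<in> R\<^sup>*}"
  assume "(x, y) \<notin> {(a, b :: 'a). dist a b < r}\<^sup>*"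
  then have y: "y \<notin> A" by (simp add: A_def R_def)
  have near: "b \<in> A" if "a \<in> A" "dist a b < r" for a b
    using that by (auto simp: A_def R_def intro: rtrancl_into_rtrancl)
  have sep: "r \<le> dist a b" if "a \<in> A" "b \<notin> A" for a b
    using near[of a b] that by (cases "dist a b < r") auto
  have "open A"
    unfolding open_contains_ball using near r by (intro ballI exI[of _ r]) auto
  then have A: "A \<in> sets M" by (simp add: sets_M)
  \<comment> \<open>Cutting with a ball keeps the indicator in \<open>L2 M\<close>, as
    \<open>A\<close> itself may have infinite measure.\<close>
  define S where "S = A \<inter> ball x 1"
  have S: "S \<in> sets M" unfolding S_def using A by auto
  have "emeasure M S \<le> emeasure M (ball x 1)" unfolding S_def by (intro emeasure_mono) auto
  then have Sfin: "emeasure M S < \<infinity>" using emeasure_ball_finite[of x 1] by (rule le_less_trans)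
  have ball_pos: "0 < emeasure M (ball z s)" if "0 < s" for z s
  proof -
    have "0 < ennreal (c1 * s powr d)" using that c1_pos by simp
    also have "\<dots> \<le> emeasure M (ball z s)" using that by (intro ball_lower) simp
    finally show ?thesis .
  qed
  have "x \<in> A" by (simp add: A_def)
  then have "ball x (min r 1) \<subseteq> S" using near by (auto simp: S_def)
  then have Spos: "0 < emeasure M S"
    using ball_pos[of "min r 1" x] r emeasure_mono[OF _ S] by (meson less_le_trans min_less_iff_conj zero_less_one)
  have "(\<lambda>x. (indicat_real S x)\<^sup>2) = indicat_real S" by (auto simp: indicator_def)
  then have L2: "indicator S \<in> L2 M" using S Sfin by (simp add: L2_def integrable_indicator_iff)
  have B: "- A \<in> sets M" using A sets.compl_sets[OF A] by (simp add: Compl_eq_Diff_UNIV)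
  define h where "h z = indicator (- A) z * P 1 (indicator S) z" for z
  have "L2_normsq M h = 0"
    unfolding h_def using invariant_if_separated[OF r A sep L2] by (auto simp: S_def)
  moreover have "h \<in> L2 M" unfolding h_def by (intro L2_indicator P_L2 L2 B) simp
  ultimately have "AE z in M. (h z)\<^sup>2 = 0"
    unfolding L2_normsq_def L2_def by (subst (asm) integral_nonneg_eq_0_iff_AE) auto
  with P_indicator_pos[OF S Sfin Spos] have "AE z in M. z \<in> A"
    by eventually_elim (auto simp: h_def indicator_def split: if_splits)
  then have "AE z in M. z \<notin> - A" by simp
  then have "emeasure M (- A) = 0" using B AE_iff_null_sets[OF B] by (simp add: null_setsD1)
  moreover have "ball y r \<subseteq> - A"
    using sep y by (force simp: dist_commute)
  then have "emeasure M (ball y r) \<le> emeasure M (- A)" by (rule emeasure_mono) (rule B)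
  ultimately show False using ball_pos[OF r, of y] by simp
qed

end

section \<open>Boundedness and oscillation at the critical exponent\<close>

theorem proposition4p20:
  fixes M :: "'a::metric_space measure"
    and E :: "('a \<Rightarrow> real) \<Rightarrow> ('a \<Rightarrow> real) \<Rightarrow> real"
    and F :: "('a \<Rightarrow> real) set"
    and P :: "real \<Rightarrow> ('a \<Rightarrow> real) \<Rightarrow> 'a \<Rightarrow> real"
    and p :: "real \<Rightarrow> 'a \<Rightarrow> 'a \<Rightarrow> real"
    and dH dW \<kappa> :: real
  assumes space: "sub_gaussian_dirichlet_space M E F P p dH dW"
    and wbe: "wBE M p dW \<kappa>"
    and kappa_crit: "ereal \<kappa> = ereal dW - crit_exponent M"
    and kappa_dim: "\<kappa> = dW - dH"
    and kappa_pos: "\<kappa> > 0"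
  shows "BV M \<subseteq> Linf M \<and> (\<exists>C>0::real. \<forall>f\<in>BV M. Osc M f \<le> ennreal C * Var M f)"
proof -
  interpret X: sub_gaussian_dirichlet_space M E F P p dH dW by (rule space)
  have setsM: "sets M = sets borel" using X.radon by (simp add: radon_measure_def)
  obtain c1 c2 where c: "0 < dH" "0 < c1" "0 < c2" "\<And>x r. 0 \<le> r \<Longrightarrow>
      ennreal (c1 * r powr dH) \<le> emeasure M (ball x r) \<and>
      emeasure M (ball x r) \<le> ennreal (c2 * r powr dH)"
    using X.ahlfors unfolding ahlfors_regular_def by auto
  interpret S: ahlfors_space M dH c1 c2
    by unfold_locales (use c setsM X.ball_closure_compact in auto)
  obtain c3 c4 c5 c6 where k: "0 < c3" "0 < c4" "0 < c5" "0 < c6"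
    "\<And>t. 0 < t \<Longrightarrow> AE (x, y) in M \<Otimes>\<^sub>M M.
        c5 * sub_gaussian_profile dH dW c6 t (dist x y) \<le> p t x y \<and>
        p t x y \<le> c3 * sub_gaussian_profile dH dW c4 t (dist x y)"
    using X.kernel_bounds unfolding sub_gaussian_bounds_def by blast
  have p_meas: "p t x \<in> borel_measurable M" if t: "0 < t" for t x
  proof -
    have "continuous_on UNIV (\<lambda>(x, y). p t x y)"
      using X.heat_kernel t by (simp add: continuous_heat_kernel_def)
    then have "continuous_on UNIV (\<lambda>y. (\<lambda>(x, y). p t x y) (x, y))"
      by (rule continuous_on_compose2) (auto intro!: continuous_intros)
    then show ?thesis
      unfolding measurable_cong_sets[OF setsM refl]
      by (intro borel_measurable_continuous_onI) simp
  qed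
  interpret G: sub_gaussian_semigroup M dH c1 c2 P p dW c3 c4 c5 c6
  proof
    show "L2_semigroup M P" using X.semigroup by (simp add: heat_semigroup_def)
    show "AE x in M. P t g x = kernel_op M p t g x" if "0 < t" "g \<in> L2 M" for t g
      using X.heat_kernel that by (simp add: continuous_heat_kernel_def)
    show "AE x in M. AE y in M.
        c5 * sub_gaussian_profile dH dW c6 t (dist x y) \<le> p t x y \<and>
        p t x y \<le> c3 * sub_gaussian_profile dH dW c4 t (dist x y)" if "0 < t" for t
      \<comment> \<open>The bound for almost every pair yields the iterated form.\<close>
      using S.pair.AE_pair[OF k(5)[OF that]] by simp
  qed (use p_meas X.dW_gt_2 k in auto)
  \<comment> \<open>An infinite critical exponent would make the right side of
    \<open>kappa_crit\<close> infinite, so the exponent is finite and the conversion to a real does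
    not fall back on its default value.\<close>
  have crit: "real_of_ereal (crit_exponent M) = dH"
    using kappa_crit kappa_dim by (cases "crit_exponent M") auto
  have "f \<in> Linf M \<and> Osc M f \<le> ennreal S.osc_const * Var M f" if "f \<in> BV M" for f
    using S.KS_Linf_Osc_le[OF G.chain_connected, of f] that by (simp add: BV_def Var_def crit)
  then show ?thesis using S.osc_const_pos by blast
qed

end
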